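(* Let $k$ be a field of characteristic zero, $A$ an associative unital $k$-algebra, $B$ a commutative unital $k$-algebra, and $\varepsilon:B\to A$ a morphism of $k$-algebras with $\varepsilon(B)\subset\mathcal{Z}(A)$ (the center of $A$). Then there is a long exact sequence $$\cdots\rightarrow HC^n(A,B,\varepsilon)\stackrel{I}{\rightarrow} HH^n(A,B,\varepsilon)\stackrel{\mathsf{B}}{\rightarrow} HC^{n-1}(A,B,\varepsilon)\stackrel{S}{\rightarrow} HC^{n+1}(A,B,\varepsilon)\stackrel{I}{\rightarrow}\cdots,$$ where $I$ is induced by the inclusion of complexes $C^{\bullet}_{\lambda}(A,B,\varepsilon)\to C^{\bullet}(A,B,\varepsilon)$. Here $HH^\bullet(A,B,\varepsilon)$ is the secondary Hochschild cohomology and $HC^\bullet(A,B,\varepsilon)$ the secondary cyclic cohomology of the triple $(A,B,\varepsilon)$.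
   Context: All tensor products are over $k$. For $n\ge 0$ put $C_n(A,B,\varepsilon)=A^{\otimes(n+1)}\otimes B^{\otimes \frac{n(n+1)}{2}}$. A simple tensor $T$ in it is displayed as an upper triangular array with diagonal entries $a_0,\dots,a_n\in A$ and entries $b_{p,q}\in B$ for $0\le p<q\le n$ above the diagonal (and $1\in k$ below the diagonal); write $T=(a_l;b_{p,q})$. The following $k$-linear maps are given on simple tensors. Face maps $\delta_i:C_{n+1}(A,B,\varepsilon)\to C_{n}(A,B,\varepsilon)$, $0\le i\le n+1$: - For $0\le i\le n$, $\delta_i$ merges the indices $i$ and $i+1$: $\delta_i(a_l;b_{p,q})=(a'_l;b'_{u,v})$ with $a'_l=a_l$ for $l<i$, $a'_i=a_ia_{i+1}\varepsilon(b_{i,i+1})$, $a'_l=a_{l+1}$ for $l>i$, and $b'_{u,v}=\prod_{p\in s^{-1}(u),\,q\in s^{-1}(v)}b_{p,q}$ for $0\le u<v\le n$, where $s:\{0,\dots,n+1\}\to\{0,\dots,n\}$ is $s(p)=p$ for $p\le i$ and $s(p)=p-1$ for $p>i$. - $\delta_{n+1}(a_l;b_{p,q})=(a'_l;b'_{u,v})$ with $a'_0=a_{n+1}a_0\varepsilon(b_{0,n+1})$, $a'_l=a_l$ for $1\le l\le n$, $b'_{0,v}=b_{v,n+1}b_{0,v}$ for $1\le v\le n$, and $b'_{u,v}=b_{u,v}$ for $1\le u<v\le n$. Cyclic map $\tau:C_n(A,B,\varepsilon)\to C_n(A,B,\varepsilon)$: $\tau(a_l;b_{p,q})=(a'_l;b'_{u,v})$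 with $a'_0=a_n$, $a'_l=a_{l-1}$ for $1\le l\le n$, $b'_{0,v}=b_{v-1,n}$ for $1\le v\le n$, $b'_{u,v}=b_{u-1,v-1}$ for $1\le u<v\le n$. Let $C^n(A,B,\varepsilon)=\mathrm{Hom}_k(C_n(A,B,\varepsilon),k)$ with differential $b_n:C^n(A,B,\varepsilon)\to C^{n+1}(A,B,\varepsilon)$, $b_n\phi=\sum_{i=0}^{n+1}(-1)^i\,\phi\circ\delta_i$. This is a cochain complex; its $n$-th cohomology is $HH^n(A,B,\varepsilon)$. Let $\lambda$ act on $C^n(A,B,\varepsilon)$ by $\lambda\phi=(-1)^n\phi\circ\tau$ (an action of the cyclic group of order $n+1$), and let $C^n_\lambda(A,B,\varepsilon)=\mathrm{Ker}(1-\lambda)=\{\phi\in C^n(A,B,\varepsilon):\lambda\phi=\phi\}$. These subspaces form a subcomplex of $(C^\bullet(A,B,\varepsilon),b)$; its $n$-th cohomology is $HC^n(A,B,\varepsilon)$. All groups in negative degrees are zero. *)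

theory Defs
  imports
    Complex_Main
    "HOL-Library.FuncSet"
    "HOL-Library.Poly_Mapping"
    "HOL-Library.Set_Algebras"
    "HOL-Library.Function_Algebras"
begin

section \<open>Algebras over a field\<close>

text \<open>The sort \<open>{ring, monoid_mult}\<close> is that of associative unital rings; unlike \<open>ring_1\<close> it does
  not exclude the zero ring.\<close>

locale k_algebra = vector_space scale
  for scale :: "'k::field \<Rightarrow> 'a::{ring,monoid_mult} \<Rightarrow> 'a" +
  assumes scale_mult_left: "scale c x * y = scale c (x * y)"
    and scale_mult_right: "x * scale c y = scale c (x * y)"

definition algebra_hom ::
    "('k::field \<Rightarrow> 'b::{ring,monoid_mult} \<Rightarrow> 'b) \<Rightarrow> ('k \<Rightarrow> 'a::{ring,monoid_mult} \<Rightarrow> 'a)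
      \<Rightarrow> ('b \<Rightarrow> 'a) \<Rightarrow> bool" where
  "algebra_hom scB scA h \<longleftrightarrow>
     Vector_Spaces.linear scB scA h \<and> h 1 = 1 \<and> (\<forall>x y. h (x * y) = h x * h y)"


section \<open>Quotients of subspaces\<close>

text \<open>For subspaces \<open>W \<subseteq> V\<close> of an ambient space with scalar multiplication \<open>s\<close>, the quotient
  \<open>V / W\<close> is the set of cosets \<open>v + W\<close> with \<open>v \<in> V\<close>.  Its addition is the elementwise addition of
  sets from \<^theory>\<open>HOL-Library.Set_Algebras\<close> and its zero is \<open>W\<close>.  In the scalar multiplication the
  summand \<open>W\<close> matters only for the scalar \<open>0\<close>, where \<open>s 0 ` U = {0}\<close>.\<close>

definition quotient_space :: "'v::ab_group_add set \<Rightarrow> 'v set \<Rightarrow> 'v set set" where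
  "quotient_space V W = (\<lambda>v. v +o W) ` V"

definition coset_scale ::
    "('k \<Rightarrow> 'v \<Rightarrow> 'v) \<Rightarrow> 'v::ab_group_add set \<Rightarrow> 'k \<Rightarrow> 'v set \<Rightarrow> 'v set" where
  "coset_scale s W c U = s c ` U + W"

definition quotient_linear ::
    "('k \<Rightarrow> 'v \<Rightarrow> 'v) \<Rightarrow> 'v::ab_group_add set \<Rightarrow> 'v set
      \<Rightarrow> 'v set \<Rightarrow> 'v set \<Rightarrow> ('v set \<Rightarrow> 'v set) \<Rightarrow> bool" where
  "quotient_linear s V W V' W' f \<longleftrightarrow>
     f \<in> quotient_space V W \<rightarrow> quotient_space V' W' \<and>
     (\<forall>X\<in>quotient_space V W. \<forall>Y\<in>quotient_space V W. f (X + Y) = f X + f Y) \<and>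
     (\<forall>c. \<forall>X\<in>quotient_space V W. f (coset_scale s W c X) = coset_scale s W' c (f X))"


section \<open>Triangular arrays\<close>

text \<open>An array with index set \<open>{0..n}\<close> is a pair \<open>(a, b)\<close>: the diagonal entry \<open>a l\<close> for \<open>l \<le> n\<close> and
  the entry \<open>b (p, q)\<close> above the diagonal for \<open>p < q \<le> n\<close>; outside these positions both functions
  are \<open>undefined\<close>.\<close>

type_synonym ('a, 'b) array = "(nat \<Rightarrow> 'a) \<times> (nat \<times> nat \<Rightarrow> 'b)"

definition upper :: "nat \<Rightarrow> (nat \<times> nat) set" where
  "upper n = {(p, q). p < q \<and> q \<le> n}"

definition arrays :: "nat \<Rightarrow> ('a, 'b) array set" where
  "arrays n = ({..n} \<rightarrow>\<^sub>E UNIV) \<times> (upper n \<rightarrow>\<^sub>E UNIV)"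

definition merge_index :: "nat \<Rightarrow> nat \<Rightarrow> nat" where
  "merge_index i p = (if p \<le> i then p else p - 1)"

definition array_face ::
    "('b::comm_monoid_mult \<Rightarrow> 'a::monoid_mult) \<Rightarrow> nat \<Rightarrow> nat \<Rightarrow> ('a, 'b) array \<Rightarrow> ('a, 'b) array" where
  "array_face eps n i = (\<lambda>(a, b).
     if i \<le> n then
       (\<lambda>l\<in>{..n}. if l < i then a l
                   else if l = i then a i * a (i + 1) * eps (b (i, i + 1))
                   else a (l + 1),
        \<lambda>(u, v)\<in>upper n.
          \<Prod>(p, q)\<in>{(p, q). p \<le> n + 1 \<and> q \<le> n + 1 \<and> merge_index i p = u \<and> merge_index i q = v}. b (p, q))
     else
       (\<lambda>l\<in>{..n}. if l = 0 then a (n + 1) * a 0 * eps (b (0, n + 1)) else a l,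
        \<lambda>(u, v)\<in>upper n. if u = 0 then b (v, n + 1) * b (0, v) else b (u, v)))"

definition array_rotate :: "nat \<Rightarrow> ('a, 'b) array \<Rightarrow> ('a, 'b) array" where
  "array_rotate n = (\<lambda>(a, b).
     (\<lambda>l\<in>{..n}. if l = 0 then a n else a (l - 1),
      \<lambda>(u, v)\<in>upper n. if u = 0 then b (v - 1, n) else b (u - 1, v - 1)))"


section \<open>The tensor products\<close>

text \<open>The tensor product of the \<open>n + 1\<close> copies of \<open>A\<close> and the \<open>n (n + 1) / 2\<close> copies of \<open>B\<close> is the
  vector space freely spanned by the arrays, modulo the span of the multilinearity relations.\<close>

definition free_scale :: "'k::field \<Rightarrow> ('x \<Rightarrow>\<^sub>0 'k) \<Rightarrow> ('x \<Rightarrow>\<^sub>0 'k)" where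
  "free_scale c f = Poly_Mapping.map ((*) c) f"

definition free_map :: "('x \<Rightarrow> 'y) \<Rightarrow> ('x \<Rightarrow>\<^sub>0 'k::field) \<Rightarrow> ('y \<Rightarrow>\<^sub>0 'k)" where
  "free_map g f = (\<Sum>x\<in>Poly_Mapping.keys f. Poly_Mapping.single (g x) (Poly_Mapping.lookup f x))"

definition free_arrays :: "nat \<Rightarrow> (('a, 'b) array \<Rightarrow>\<^sub>0 'k::field) set" where
  "free_arrays n = {f. Poly_Mapping.keys f \<subseteq> arrays n}"

definition multilinearity_gens ::
    "('k::field \<Rightarrow> 'a::ab_group_add \<Rightarrow> 'a) \<Rightarrow> ('k \<Rightarrow> 'b::ab_group_add \<Rightarrow> 'b) \<Rightarrow> nat
      \<Rightarrow> (('a, 'b) array \<Rightarrow>\<^sub>0 'k) set" where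
  "multilinearity_gens scA scB n =
     {Poly_Mapping.single (a(l := x + y), b) 1
        - Poly_Mapping.single (a(l := x), b) 1 - Poly_Mapping.single (a(l := y), b) 1
      | a b l x y. (a, b) \<in> arrays n \<and> l \<le> n}
   \<union> {Poly_Mapping.single (a(l := scA c x), b) 1 - Poly_Mapping.single (a(l := x), b) c
      | a b l c x. (a, b) \<in> arrays n \<and> l \<le> n}
   \<union> {Poly_Mapping.single (a, b(e := x + y)) 1
        - Poly_Mapping.single (a, b(e := x)) 1 - Poly_Mapping.single (a, b(e := y)) 1
      | a b e x y. (a, b) \<in> arrays n \<and> e \<in> upper n}
   \<union> {Poly_Mapping.single (a, b(e := scB c x)) 1 - Poly_Mapping.single (a, b(e := x)) c
      | a b e c x. (a, b) \<in> arrays n \<and> e \<in> upper n}"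

definition tensor_rel ::
    "('k::field \<Rightarrow> 'a::ab_group_add \<Rightarrow> 'a) \<Rightarrow> ('k \<Rightarrow> 'b::ab_group_add \<Rightarrow> 'b) \<Rightarrow> nat
      \<Rightarrow> (('a, 'b) array \<Rightarrow>\<^sub>0 'k) set" where
  "tensor_rel scA scB n = module.span free_scale (multilinearity_gens scA scB n)"

definition chains ::
    "('k::field \<Rightarrow> 'a::ab_group_add \<Rightarrow> 'a) \<Rightarrow> ('k \<Rightarrow> 'b::ab_group_add \<Rightarrow> 'b) \<Rightarrow> nat
      \<Rightarrow> (('a, 'b) array \<Rightarrow>\<^sub>0 'k) set set" where
  "chains scA scB n = quotient_space (free_arrays n) (tensor_rel scA scB n)"

text \<open>The linear maps between these quotients with the prescribed values on simple tensors: the coset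
  of \<open>f\<close> is sent to the coset of \<^term>\<open>free_map g f\<close>.\<close>

definition face ::
    "('k::field \<Rightarrow> 'a::{ring,monoid_mult} \<Rightarrow> 'a) \<Rightarrow> ('k \<Rightarrow> 'b::{comm_ring,comm_monoid_mult} \<Rightarrow> 'b)
      \<Rightarrow> ('b \<Rightarrow> 'a) \<Rightarrow> nat \<Rightarrow> nat
      \<Rightarrow> (('a, 'b) array \<Rightarrow>\<^sub>0 'k) set \<Rightarrow> (('a, 'b) array \<Rightarrow>\<^sub>0 'k) set" where
  "face scA scB eps n i U = free_map (array_face eps n i) ` U + tensor_rel scA scB n"

definition rotate_chain ::
    "('k::field \<Rightarrow> 'a::ab_group_add \<Rightarrow> 'a) \<Rightarrow> ('k \<Rightarrow> 'b::ab_group_add \<Rightarrow> 'b) \<Rightarrow> nat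
      \<Rightarrow> (('a, 'b) array \<Rightarrow>\<^sub>0 'k) set \<Rightarrow> (('a, 'b) array \<Rightarrow>\<^sub>0 'k) set" where
  "rotate_chain scA scB n U = free_map (array_rotate n) ` U + tensor_rel scA scB n"


section \<open>The cochain complexes\<close>

type_synonym ('a, 'b, 'k) cochain = "(('a, 'b) array \<Rightarrow>\<^sub>0 'k) set \<Rightarrow> 'k"

text \<open>Linear functionals on \<^const>\<open>chains\<close>, extended by \<open>0\<close> outside their domain so that
  the pointwise operations on functions are the vector space operations.\<close>

definition cochains ::
    "('k::field \<Rightarrow> 'a::ab_group_add \<Rightarrow> 'a) \<Rightarrow> ('k \<Rightarrow> 'b::ab_group_add \<Rightarrow> 'b) \<Rightarrow> nat
      \<Rightarrow> ('a, 'b, 'k) cochain set" where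
  "cochains scA scB n = {\<phi>.
     (\<forall>U. U \<notin> chains scA scB n \<longrightarrow> \<phi> U = 0) \<and>
     (\<forall>U\<in>chains scA scB n. \<forall>V\<in>chains scA scB n. \<phi> (U + V) = \<phi> U + \<phi> V) \<and>
     (\<forall>c. \<forall>U\<in>chains scA scB n. \<phi> (coset_scale free_scale (tensor_rel scA scB n) c U) = c * \<phi> U)}"

definition cochain_scale :: "'k::field \<Rightarrow> ('x \<Rightarrow> 'k) \<Rightarrow> ('x \<Rightarrow> 'k)" where
  "cochain_scale c \<phi> = (\<lambda>x. c * \<phi> x)"

definition codiff ::
    "('k::field \<Rightarrow> 'a::{ring,monoid_mult} \<Rightarrow> 'a) \<Rightarrow> ('k \<Rightarrow> 'b::{comm_ring,comm_monoid_mult} \<Rightarrow> 'b)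
      \<Rightarrow> ('b \<Rightarrow> 'a) \<Rightarrow> nat \<Rightarrow> ('a, 'b, 'k) cochain \<Rightarrow> ('a, 'b, 'k) cochain" where
  "codiff scA scB eps n \<phi> = (\<lambda>U.
     if U \<in> chains scA scB (n + 1)
     then \<Sum>i\<le>n + 1. (- 1) ^ i * \<phi> (face scA scB eps n i U)
     else 0)"

definition cyclic_act ::
    "('k::field \<Rightarrow> 'a::ab_group_add \<Rightarrow> 'a) \<Rightarrow> ('k \<Rightarrow> 'b::ab_group_add \<Rightarrow> 'b) \<Rightarrow> nat
      \<Rightarrow> ('a, 'b, 'k) cochain \<Rightarrow> ('a, 'b, 'k) cochain" where
  "cyclic_act scA scB n \<phi> = (\<lambda>U.
     if U \<in> chains scA scB n then (- 1) ^ n * \<phi> (rotate_chain scA scB n U) else 0)"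

definition cyclic_cochains ::
    "('k::field \<Rightarrow> 'a::ab_group_add \<Rightarrow> 'a) \<Rightarrow> ('k \<Rightarrow> 'b::ab_group_add \<Rightarrow> 'b) \<Rightarrow> nat
      \<Rightarrow> ('a, 'b, 'k) cochain set" where
  "cyclic_cochains scA scB n = {\<phi> \<in> cochains scA scB n. cyclic_act scA scB n \<phi> = \<phi>}"


section \<open>Cohomology\<close>

text \<open>Cocycles and coboundaries, in integer degrees, of a complex \<open>C 0 \<rightarrow> C 1 \<rightarrow> \<dots>\<close> with differentials
  \<open>d n : C n \<rightarrow> C (n + 1)\<close>, extended by zero to negative degrees.\<close>

definition cocycles :: "(nat \<Rightarrow> 'v::ab_group_add set) \<Rightarrow> (nat \<Rightarrow> 'v \<Rightarrow> 'v) \<Rightarrow> int \<Rightarrow> 'v set" where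
  "cocycles C d n = (if n < 0 then {0} else {x \<in> C (nat n). d (nat n) x = 0})"

definition coboundaries :: "(nat \<Rightarrow> 'v::ab_group_add set) \<Rightarrow> (nat \<Rightarrow> 'v \<Rightarrow> 'v) \<Rightarrow> int \<Rightarrow> 'v set" where
  "coboundaries C d n = (if n \<le> 0 then {0} else d (nat (n - 1)) ` C (nat (n - 1)))"

context
  fixes scA :: "'k::field \<Rightarrow> 'a::{ring,monoid_mult} \<Rightarrow> 'a"
    and scB :: "'k \<Rightarrow> 'b::{comm_ring,comm_monoid_mult} \<Rightarrow> 'b"
    and eps :: "'b \<Rightarrow> 'a"
begin

definition HH_cocycles :: "int \<Rightarrow> ('a, 'b, 'k) cochain set" where
  "HH_cocycles = cocycles (cochains scA scB) (codiff scA scB eps)"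

definition HH_coboundaries :: "int \<Rightarrow> ('a, 'b, 'k) cochain set" where
  "HH_coboundaries = coboundaries (cochains scA scB) (codiff scA scB eps)"

definition HH :: "int \<Rightarrow> ('a, 'b, 'k) cochain set set" where
  "HH n = quotient_space (HH_cocycles n) (HH_coboundaries n)"

definition HC_cocycles :: "int \<Rightarrow> ('a, 'b, 'k) cochain set" where
  "HC_cocycles = cocycles (cyclic_cochains scA scB) (codiff scA scB eps)"

definition HC_coboundaries :: "int \<Rightarrow> ('a, 'b, 'k) cochain set" where
  "HC_coboundaries = coboundaries (cyclic_cochains scA scB) (codiff scA scB eps)"

definition HC :: "int \<Rightarrow> ('a, 'b, 'k) cochain set set" where
  "HC n = quotient_space (HC_cocycles n) (HC_coboundaries n)"

text \<open>The map induced by the inclusion of the subcomplex: the class of a cyclic cocycle \<open>\<phi>\<close> modulo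
  cyclic coboundaries is sent to its class modulo all coboundaries.\<close>

definition I_map :: "int \<Rightarrow> ('a, 'b, 'k) cochain set \<Rightarrow> ('a, 'b, 'k) cochain set" where
  "I_map n X = X + HH_coboundaries n"

definition HC_to_HH_linear ::
    "int \<Rightarrow> int \<Rightarrow> (('a, 'b, 'k) cochain set \<Rightarrow> ('a, 'b, 'k) cochain set) \<Rightarrow> bool" where
  "HC_to_HH_linear m n =
     quotient_linear cochain_scale (HC_cocycles m) (HC_coboundaries m) (HH_cocycles n) (HH_coboundaries n)"

definition HH_to_HC_linear ::
    "int \<Rightarrow> int \<Rightarrow> (('a, 'b, 'k) cochain set \<Rightarrow> ('a, 'b, 'k) cochain set) \<Rightarrow> bool" where
  "HH_to_HC_linear m n =
     quotient_linear cochain_scale (HH_cocycles m) (HH_coboundaries m) (HC_cocycles n) (HC_coboundaries n)"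

definition HC_to_HC_linear ::
    "int \<Rightarrow> int \<Rightarrow> (('a, 'b, 'k) cochain set \<Rightarrow> ('a, 'b, 'k) cochain set) \<Rightarrow> bool" where
  "HC_to_HC_linear m n =
     quotient_linear cochain_scale (HC_cocycles m) (HC_coboundaries m) (HC_cocycles n) (HC_coboundaries n)"

end

end

theory Submission
  imports Defs
begin

text \<open>Let \<open>\<lambda>\<close> be the signed cyclic action, \<open>t = 1 - \<lambda>\<close>, let \<open>N\<close> be the sum of the powers of \<open>\<lambda>\<close>, and let
\<open>d'\<close> be the differential \<open>d\<close> without its last coface.  Cyclic cochains are the kernel of \<open>t\<close>.  In degree
\<open>n\<close> the operator \<open>\<lambda>\<close> has order dividing \<open>n + 1\<close>, which is invertible in \<open>k\<close>, so the kernel of \<open>t\<close> is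
the image of \<open>N\<close> and the kernel of \<open>N\<close> is the image of \<open>t\<close>.  The identities \<open>t d = d' t\<close> and
\<open>N d' = d N\<close> make
\<open>0 \<rightarrow> C\<^sub>\<lambda> \<rightarrow> (C, d) \<rightarrow> (C, d') \<rightarrow> C\<^sub>\<lambda> \<rightarrow> 0\<close>,
with \<open>t\<close> and \<open>N\<close> as the last two nonzero maps, an exact sequence of complexes.  The complex
\<open>(C, d')\<close> is contractible, because the unit of the algebra can be inserted in front of an array.  Hence the cohomology of
\<open>C / C\<^sub>\<lambda>\<close> in degree \<open>n\<close> is that of the kernel of \<open>N\<close>, which is the cyclic cohomology in degree \<open>n - 1\<close>,
and the long exact sequence of \<open>C\<^sub>\<lambda> \<subseteq> C\<close> is the assertion.

Explicit operators replace the two connecting homomorphisms.  Let \<open>h\<close> be the contraction of \<open>d'\<close>,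
\<open>E\<close> a section of \<open>N\<close> over the kernel of \<open>t\<close>, and \<open>D\<close> a section of \<open>t\<close> over the kernel of \<open>N\<close>.  Then
\<open>\<B> = N h t\<close> and \<open>S = d D d' E\<close>, and exactness is verified on representatives
(\<open>inclusion_exact\<close>, \<open>connecting_exact\<close>, \<open>periodicity_exact\<close>).

That the cochains of the triple admit this structure rests on a few identities between operations on
triangular arrays: the rotation has finite order and conjugates each face into the next one, the last
face is the face at \<open>0\<close> after a rotation, and merging three neighbouring indices does not depend on
the order (\<open>face_face_0\<close>; here \<open>\<epsilon>\<close> must be multiplicative with central values).  All other relations
between cofaces follow from these by conjugation with the rotation (\<open>\<delta>_\<delta>\<close>).\<close>

section \<open>Maps induced on quotients\<close>

text \<open>The image of a whole coset is used, so that no representative has to be chosen; adding \<open>W'\<close> fills the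
image up to a coset.\<close>

definition induced_map :: "('v \<Rightarrow> 'w::ab_group_add) \<Rightarrow> 'w set \<Rightarrow> 'v set \<Rightarrow> 'w set" where
  "induced_map f W' X = f ` X + W'"

lemma subspace_plus_idem:
  assumes "module.subspace s W" "module s"
  shows "W + W = (W :: 'v::ab_group_add set)"
proof -
  interpret module s by fact
  have "x \<in> W + W" if "x \<in> W" for x
    using set_plus_intro[OF that subspace_0[OF assms(1)]] by simp
  then show ?thesis
    using subspace_add[OF assms(1)] by (auto elim!: set_plus_elim)
qed

lemma coset_add_coset:
  assumes "module.subspace s W" "module s"
  shows "(x +o W) + (y +o W) = (x + y) +o (W :: 'v::ab_group_add set)"
  using subspace_plus_idem[OF assms] by (simp add: set_plus_rearrange)

lemma coset_eq_subspace_iff: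
  assumes "module.subspace s W" "module s"
  shows "v +o W = W \<longleftrightarrow> (v :: 'v::ab_group_add) \<in> W"
proof -
  interpret module s by fact
  show ?thesis
  proof
    assume "v +o W = W"
    then show "v \<in> W" using subspace_0[OF assms(1)] set_plus_intro2[of 0 W v] by simp
  next
    assume v: "v \<in> W"
    show "v +o W = W"
    proof
      show "v +o W \<subseteq> W" using v subspace_add[OF assms(1)] by (auto simp: elt_set_plus_def)
      show "W \<subseteq> v +o W"
      proof
        fix x assume "x \<in> W"
        then have "x - v \<in> W" using v subspace_diff[OF assms(1)] by blast
        then show "x \<in> v +o W" using set_plus_intro2[of "x - v" W v] by simp
      qed
    qed
  qed
qed

lemma coset_eq_iff:
  assumes "module.subspace s W" "module s"
  shows "v +o W = v' +o W \<longleftrightarrow> (v :: 'v::ab_group_add) - v' \<in> W"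
proof -
  have "v +o W = v' +o W \<longleftrightarrow> (- v') +o (v +o W) = (- v') +o (v' +o W)"
    by (metis add.right_inverse set_plus_rearrange2 set_zero_plus)
  also have "\<dots> \<longleftrightarrow> (v - v') +o W = W"
    by (simp add: set_plus_rearrange2)
  finally show ?thesis using coset_eq_subspace_iff[OF assms] by simp
qed

lemma induced_map_coset:
  assumes "module_hom s s' f" "module.subspace s' W'" "f ` W \<subseteq> W'" "0 \<in> W"
  shows "induced_map f W' (v +o W) = f v +o W'"
proof -
  interpret module_hom s s' f by fact
  have "f ` (v +o W) + W' = f v +o (f ` W + W')"
    by (auto simp: elt_set_plus_def set_plus_def image_iff add) (metis add add.assoc)+
  also have "f ` W + W' = W'"
  proof
    show "f ` W + W' \<subseteq> W'" using assms(3) m2.subspace_add[OF assms(2)]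
      by (auto elim!: set_plus_elim)
    show "W' \<subseteq> f ` W + W'" using assms(4) zero
      by (metis image_eqI set_zero_plus2)
  qed
  finally show ?thesis unfolding induced_map_def .
qed

lemma coset_scale_coset:
  assumes "module s" "module.subspace s W"
  shows "coset_scale s W c (v +o W) = s c v +o W"
proof -
  interpret module_hom s s "s c"
    using assms(1) module.module_hom_scale_self by blast
  have "induced_map (s c) W (v +o W) = s c v +o W"
    by (rule induced_map_coset[OF module_hom_axioms assms(2)])
      (use m1.subspace_scale[OF assms(2)] m1.subspace_0[OF assms(2)] in auto)
  then show ?thesis by (simp add: induced_map_def coset_scale_def)
qed

lemma quotient_space_closed:
  assumes "module s" "module.subspace s V" "module.subspace s W"
    and X: "X \<in> quotient_space V W"
  shows "Y \<in> quotient_space V W \<Longrightarrow> X + Y \<in> quotient_space V W"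
    and "coset_scale s W c X \<in> quotient_space V W"
  using X module.subspace_add[OF assms(1,2)] module.subspace_scale[OF assms(1,2)]
  by (auto simp: quotient_space_def coset_add_coset[OF assms(3,1)]
      coset_scale_coset[OF assms(1,3)])

lemma quotient_linear_induced_map:
  assumes f: "module_hom s s f"
    and W: "module.subspace s W" and W': "module.subspace s W'"
    and VV: "f ` V \<subseteq> V'" and WW: "f ` W \<subseteq> W'"
  shows "quotient_linear s V W V' W' (induced_map f W')"
proof -
  interpret module_hom s s f by fact
  note coset = induced_map_coset[OF f W' WW m1.subspace_0[OF W]]
  note plus1 = coset_add_coset[OF W m1.module_axioms]
    and plus2 = coset_add_coset[OF W' m1.module_axioms]
  note scale1 = coset_scale_coset[OF m1.module_axioms W]
    and scale2 = coset_scale_coset[OF m1.module_axioms W']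
  show ?thesis
    unfolding quotient_linear_def quotient_space_def
  proof (intro conjI allI ballI)
    show "induced_map f W' \<in> (\<lambda>v. v +o W) ` V \<rightarrow> (\<lambda>v. v +o W') ` V'"
      using VV by (auto simp: coset)
  qed (auto simp only: coset plus1 plus2 scale1 scale2 add scale image_iff)
qed

text \<open>Exactness at \<open>V' / W'\<close> can be tested on representatives; the rest of the development works only with
vectors and never with cosets.\<close>

lemma induced_map_exact:
  assumes f: "module_hom s s f" and g: "module_hom s s g"
    and W: "module.subspace s W" and W': "module.subspace s W'" and W'': "module.subspace s W''"
    and V': "module.subspace s V'" and sub: "W' \<subseteq> V'"
    and VV: "f ` V \<subseteq> V'" and WW: "f ` W \<subseteq> W'" and WW': "g ` W' \<subseteq> W''"
    and complex: "\<And>v. v \<in> V \<Longrightarrow> g (f v) \<in> W''"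
    and exact: "\<And>x. x \<in> V' \<Longrightarrow> g x \<in> W'' \<Longrightarrow> \<exists>v\<in>V. x - f v \<in> W'"
  shows "induced_map f W' ` quotient_space V W
      = {X \<in> quotient_space V' W'. induced_map g W'' X = W''}"
proof -
  interpret f: module_hom s s f by fact
  interpret g: module_hom s s g by fact
  note cf = induced_map_coset[OF f W' WW f.m1.subspace_0[OF W]]
  note cg = induced_map_coset[OF g W'' WW' f.m1.subspace_0[OF W']]
  note triv = coset_eq_subspace_iff[OF W'' f.m1.module_axioms]
  note eq = coset_eq_iff[OF W' f.m1.module_axioms]
  have "induced_map f W' ` quotient_space V W = (\<lambda>v. f v +o W') ` V"
    by (simp add: quotient_space_def image_image cf)
  also have "\<dots> = {X \<in> quotient_space V' W'. induced_map g W'' X = W''}"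
  proof (intro equalityI subsetI)
    fix X assume "X \<in> (\<lambda>v. f v +o W') ` V"
    then show "X \<in> {X \<in> quotient_space V' W'. induced_map g W'' X = W''}"
      using VV complex by (force simp: quotient_space_def cg triv)
  next
    fix X assume "X \<in> {X \<in> quotient_space V' W'. induced_map g W'' X = W''}"
    then obtain x where "x \<in> V'" "X = x +o W'" "g x \<in> W''"
      by (auto simp: quotient_space_def cg triv)
    with exact show "X \<in> (\<lambda>v. f v +o W') ` V"
      by (metis eq imageI)
  qed
  finally show ?thesis .
qed

section \<open>The long exact sequence of a periodic bicomplex\<close>

text \<open>Two columns of a bicomplex with periodic rows: \<open>t\<close> maps the complex \<open>(C, d)\<close> to \<open>(C, d')\<close> and \<open>N\<close> maps
back, with the kernel of either being the image of the other.  The operators \<open>D\<close> and \<open>E\<close> are linear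
sections that witness this exactness, and \<open>h\<close> contracts the second column.  Degrees are integers because
the shift by two in the periodicity map then needs no separate treatment of low degrees.\<close>

locale periodic_bicomplex = vector_space scale
  for scale :: "'k::field \<Rightarrow> 'v::ab_group_add \<Rightarrow> 'v" +
  fixes C :: "int \<Rightarrow> 'v set"
    and d d' h t N D E :: "int \<Rightarrow> 'v \<Rightarrow> 'v"
  assumes subspace_C: "subspace (C n)"
    and hom_d: "module_hom scale scale (d n)" and hom_d': "module_hom scale scale (d' n)"
    and hom_h: "module_hom scale scale (h n)" and hom_t: "module_hom scale scale (t n)"
    and hom_N: "module_hom scale scale (N n)" and hom_D: "module_hom scale scale (D n)"
    and hom_E: "module_hom scale scale (E n)"
    and d_in: "x \<in> C n \<Longrightarrow> d n x \<in> C (n + 1)" and d'_in: "x \<in> C n \<Longrightarrow> d' n x \<in> C (n + 1)"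
    and h_in: "y \<in> C (n + 1) \<Longrightarrow> h n y \<in> C n" and t_in: "x \<in> C n \<Longrightarrow> t n x \<in> C n"
    and N_in: "x \<in> C n \<Longrightarrow> N n x \<in> C n" and D_in: "x \<in> C n \<Longrightarrow> D n x \<in> C n"
    and E_in: "x \<in> C n \<Longrightarrow> E n x \<in> C n"
    and dd: "x \<in> C n \<Longrightarrow> d (n + 1) (d n x) = 0"
    and d'd': "x \<in> C n \<Longrightarrow> d' (n + 1) (d' n x) = 0"
    and td: "x \<in> C n \<Longrightarrow> t (n + 1) (d n x) = d' n (t n x)"
    and Nd': "x \<in> C n \<Longrightarrow> N (n + 1) (d' n x) = d n (N n x)"
    and Nt: "x \<in> C n \<Longrightarrow> N n (t n x) = 0" and tN: "x \<in> C n \<Longrightarrow> t n (N n x) = 0"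
    and tD: "x \<in> C n \<Longrightarrow> N n x = 0 \<Longrightarrow> t n (D n x) = x"
    and NE: "x \<in> C n \<Longrightarrow> t n x = 0 \<Longrightarrow> N n (E n x) = x"
    and contraction: "y \<in> C (n + 1) \<Longrightarrow> h (n + 1) (d' (n + 1) y) + d' n (h n y) = y"
begin

sublocale d: module_hom scale scale "d n" for n by (rule hom_d)
sublocale d': module_hom scale scale "d' n" for n by (rule hom_d')
sublocale h: module_hom scale scale "h n" for n by (rule hom_h)
sublocale t: module_hom scale scale "t n" for n by (rule hom_t)
sublocale N: module_hom scale scale "N n" for n by (rule hom_N)
sublocale D: module_hom scale scale "D n" for n by (rule hom_D)
sublocale E: module_hom scale scale "E n" for n by (rule hom_E)

lemmas C_diff = subspace_diff[OF subspace_C] and C_zero = subspace_0[OF subspace_C]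

text \<open>The subcomplex \<open>K\<close> is that of the cyclic cochains once \<open>t = 1 - \<lambda>\<close>; its cocycles are \<open>ZK\<close>.\<close>

definition K :: "int \<Rightarrow> 'v set" where "K n = {x \<in> C n. t n x = 0}"
definition Z :: "int \<Rightarrow> 'v set" where "Z n = {x \<in> C n. d n x = 0}"
definition ZK :: "int \<Rightarrow> 'v set" where "ZK n = {x \<in> K n. d n x = 0}"
text \<open>Both maps are connecting homomorphisms followed through with the chosen sections: a cocycle is moved by
\<open>t\<close> to the contractible column, lifted along \<open>d'\<close> by \<open>h\<close> and returned by \<open>N\<close>; a cyclic cocycle is
lifted along \<open>N\<close> by \<open>E\<close>, and after \<open>d'\<close> lifted again along \<open>t\<close> by \<open>D\<close>.\<close>

definition connecting :: "int \<Rightarrow> 'v \<Rightarrow> 'v" where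
  "connecting n = N n \<circ> h n \<circ> t (n + 1)"
definition periodicity :: "int \<Rightarrow> 'v \<Rightarrow> 'v" where
  "periodicity n = d (n + 1) \<circ> D (n + 1) \<circ> d' n \<circ> E n"

lemma hom_connecting: "module_hom scale scale (connecting n)"
  unfolding connecting_def by (rule module_hom_compose[OF hom_t module_hom_compose[OF hom_h hom_N]])

lemma hom_periodicity: "module_hom scale scale (periodicity n)"
  unfolding periodicity_def
  by (rule module_hom_compose[OF hom_E module_hom_compose[OF hom_d' module_hom_compose[OF hom_D hom_d]]])

lemma subspace_K: "subspace (K n)"
  unfolding K_def
  by (rule subspaceI) (simp_all add: C_zero t.zero t.add t.scale
        subspace_add[OF subspace_C] subspace_scale[OF subspace_C])

lemma subspace_Z: "subspace (Z n)"
  unfolding Z_def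
  by (rule subspaceI) (simp_all add: C_zero d.zero d.add d.scale
        subspace_add[OF subspace_C] subspace_scale[OF subspace_C])

lemma subspace_ZK: "subspace (ZK n)"
  unfolding ZK_def
  by (rule subspaceI) (simp_all add: subspace_0[OF subspace_K] d.zero d.add d.scale
        subspace_add[OF subspace_K] subspace_scale[OF subspace_K])

lemma subspace_dC: "subspace (d n ` C n)" and subspace_dK: "subspace (d n ` K n)"
  using d.subspace_image subspace_C subspace_K by blast+

lemma K_in: "x \<in> K n \<Longrightarrow> x \<in> C n" by (simp add: K_def)

lemma ZK_in_Z: "ZK n \<subseteq> Z n" by (auto simp: ZK_def K_def Z_def)

lemma d_K: "x \<in> K n \<Longrightarrow> d n x \<in> K (n + 1)"
  by (simp add: K_def d_in td d'.zero)

lemma N_K: "x \<in> C n \<Longrightarrow> N n x \<in> K n"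
  by (simp add: K_def N_in tN)

lemma dK_in_ZK: "d n ` K n \<subseteq> ZK (n + 1)"
  by (auto simp: ZK_def d_K dd K_in)

lemma dC_in_Z: "d n ` C n \<subseteq> Z (n + 1)"
  by (auto simp: Z_def d_in dd)

lemma K_eq_N: assumes "x \<in> K n" obtains y where "y \<in> C n" "x = N n y"
  using assms E_in NE by (metis (mono_tags, lifting) K_def mem_Collect_eq)

lemma N_eq_t:
  assumes "x \<in> C n" "y \<in> C n" "N n x = N n y"
  obtains z where "z \<in> C n" "x - y = t n z"
proof
  have "N n (x - y) = 0" using assms by (simp add: N.diff)
  then show "D n (x - y) \<in> C n" "x - y = t n (D n (x - y))"
    using assms by (simp_all add: D_in C_diff tD)
qed

lemma d'_h_cocycle: "y \<in> C (n + 1) \<Longrightarrow> d' (n + 1) y = 0 \<Longrightarrow> d' n (h n y) = y"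
  using contraction[of y n] by (simp add: h.zero)

lemma connecting_Z:
  assumes "x \<in> Z (n + 1)" shows "connecting n x \<in> ZK n"
proof -
  from assms have x: "x \<in> C (n + 1)" "d (n + 1) x = 0" by (auto simp: Z_def)
  have "d' (n + 1) (t (n + 1) x) = 0" using td[of x "n + 1"] x by (simp add: t.zero)
  then have "d' n (h n (t (n + 1) x)) = t (n + 1) x" using x by (simp add: d'_h_cocycle t_in)
  then have "d n (connecting n x) = N (n + 1) (t (n + 1) x)"
    using x Nd'[of "h n (t (n + 1) x)" n] by (simp add: connecting_def h_in t_in)
  then show ?thesis using x by (simp add: ZK_def Nt connecting_def N_K h_in t_in)
qed

text \<open>On coboundaries \<open>N h t d = N h d' t = N (1 - d' h) t = - d N h t\<close>, as \<open>N t = 0\<close>; the last term is a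
coboundary of a cyclic cochain.\<close>

lemma connecting_coboundary:
  assumes "y \<in> C n" shows "connecting n (d n y) \<in> d (n - 1) ` K (n - 1)"
proof -
  let ?y = "h (n - 1) (t n y)"
  have y: "t n y \<in> C (n - 1 + 1)" "?y \<in> C (n - 1)" using assms t_in h_in[of "t n y" "n - 1"] by simp_all
  have "h n (d' n (t n y)) = t n y - d' (n - 1) ?y"
    using contraction[OF y(1)] by (simp add: algebra_simps)
  then have "connecting n (d n y) = - d (n - 1) (N (n - 1) ?y)"
    using assms Nd'[OF y(2)] by (simp add: connecting_def td N.diff Nt)
  then show ?thesis
    using y(2) N_K subspace_neg[OF subspace_dK] by auto
qed

lemma connecting_K: "x \<in> K (n + 1) \<Longrightarrow> connecting n x = 0"
  by (simp add: connecting_def K_def h.zero N.zero)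

text \<open>Modulo coboundaries of \<open>K\<close>, the periodicity map does not depend on the sections: any \<open>y\<close> over a given
cyclic cocycle and any \<open>x\<close> over \<open>d' y\<close> give the same class.  The two choices of \<open>y\<close> differ by some
\<open>t z\<close>, and the two choices of \<open>x\<close>, corrected by \<open>d z\<close>, differ by an element of \<open>K\<close>.  This is the tool
for every later statement on the periodicity map.\<close>

lemma periodicity_N:
  assumes y: "y \<in> C n" and x: "x \<in> C (n + 1)" and tx: "t (n + 1) x = d' n y"
  shows "periodicity n (N n y) - d (n + 1) x \<in> d (n + 1) ` K (n + 1)"
proof -
  let ?e = "E n (N n y)"
  let ?w = "D (n + 1) (d' n ?e)"
  have e: "?e \<in> C n" "N n ?e = N n y" using y by (simp_all add: E_in N_in NE tN)
  have "N (n + 1) (d' n ?e) = N (n + 1) (d' n y)" using e y by (simp add: Nd')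
  also have "\<dots> = 0" using x by (simp add: Nt flip: tx)
  finally have w: "?w \<in> C (n + 1)" "t (n + 1) ?w = d' n ?e"
    using e by (simp_all add: tD D_in d'_in)
  obtain z where z: "z \<in> C n" "?e - y = t n z" using N_eq_t[OF e(1) y e(2)] .
  have dz: "d n z \<in> C (n + 1)" using z(1) by (rule d_in)
  have "t (n + 1) (?w - x - d n z) = d' n (?e - y - t n z)"
    using w(2) tx z(1) by (simp only: t.diff d'.diff td)
  also have "\<dots> = 0" unfolding z(2) by (simp add: d'.zero)
  finally have "?w - x - d n z \<in> K (n + 1)"
    using w x dz by (simp add: K_def C_diff)
  moreover have "d (n + 1) (?w - x - d n z) = periodicity n (N n y) - d (n + 1) x"
    using z dd[of z n] by (simp add: d.diff periodicity_def)
  ultimately show ?thesis by force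
qed

lemma lift_cocycle:
  assumes "x \<in> ZK n"
  obtains y z where "y \<in> C n" "N n y = x" "z \<in> C (n + 1)" "t (n + 1) z = d' n y"
proof -
  have x: "x \<in> K n" "d n x = 0" using assms by (auto simp: ZK_def)
  obtain y where y: "y \<in> C n" "x = N n y" using K_eq_N[OF x(1)] .
  have "N (n + 1) (d' n y) = 0" using x y by (simp add: Nd')
  with y show ?thesis by (intro that[of y "D (n + 1) (d' n y)"]) (simp_all add: tD D_in d'_in)
qed

lemma coboundary_in_ZK:
  assumes "y \<in> C n" "z \<in> C (n + 1)" "t (n + 1) z = d' n y"
  shows "d (n + 1) z \<in> ZK (n + 2)"
proof -
  have [simp]: "n + 1 + 1 = n + 2" by simp
  show ?thesis
    using assms td[of z "n + 1"] d_in[of z "n + 1"] dd[of z "n + 1"] d'd'[of y n]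
    by (simp add: ZK_def K_def)
qed

lemma dK_in_ZK2: "d (n + 1) ` K (n + 1) \<subseteq> ZK (n + 2)"
  using dK_in_ZK[of "n + 1"] by (simp add: add.assoc)

lemma periodicity_ZK:
  assumes "x \<in> ZK n" shows "periodicity n x \<in> ZK (n + 2)"
proof -
  obtain y z where yz: "y \<in> C n" "N n y = x" "z \<in> C (n + 1)" "t (n + 1) z = d' n y"
    using lift_cocycle[OF assms] .
  have "periodicity n x - d (n + 1) z \<in> ZK (n + 2)"
    using periodicity_N[OF yz(1,3,4)] yz(2) dK_in_ZK2 by blast
  from subspace_add[OF subspace_ZK this coboundary_in_ZK[OF yz(1,3,4)]] show ?thesis by simp
qed

text \<open>If \<open>y = N w\<close> then \<open>d y = N (d' w)\<close>, and \<open>0\<close> lies over \<open>d' (d' w) = 0\<close>.\<close>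

lemma periodicity_coboundary:
  assumes "y \<in> K n" shows "periodicity (n + 1) (d n y) \<in> d (n + 2) ` K (n + 2)"
proof -
  obtain w where w: "w \<in> C n" "y = N n w" using K_eq_N[OF assms] .
  have [simp]: "n + 1 + 1 = n + 2" by simp
  have "periodicity (n + 1) (N (n + 1) (d' n w)) - d (n + 1 + 1) 0 \<in> d (n + 1 + 1) ` K (n + 1 + 1)"
    by (rule periodicity_N) (use w in \<open>simp_all add: d'_in C_zero d'd' t.zero\<close>)
  then show ?thesis using w by (simp add: Nd' d.zero)
qed

text \<open>If \<open>N (h t x)\<close> is the coboundary of \<open>N y\<close>, then \<open>h t x - d' y = t z\<close> for some \<open>z\<close>.  Applying \<open>d'\<close> gives
\<open>t x = t d z\<close>, so \<open>x - d z\<close> is the required cyclic cocycle.\<close>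

lemma inclusion_exact:
  assumes "x \<in> Z (n + 1)" "connecting n x \<in> d (n - 1) ` K (n - 1)"
  shows "\<exists>k\<in>ZK (n + 1). x - k \<in> d n ` C n"
proof -
  have x: "x \<in> C (n + 1)" "d (n + 1) x = 0" using assms by (auto simp: Z_def)
  let ?w = "h n (t (n + 1) x)"
  have w: "?w \<in> C n" using x by (simp add: h_in t_in)
  have dw: "d' n ?w = t (n + 1) x"
    using td[of x "n + 1"] x by (simp add: d'_h_cocycle t_in t.zero)
  obtain k where k: "k \<in> K (n - 1)" "N n ?w = d (n - 1) k" using assms by (auto simp: connecting_def)
  obtain y where y: "y \<in> C (n - 1)" "k = N (n - 1) y" using K_eq_N[OF k(1)] .
  have y': "d' (n - 1) y \<in> C n" using d'_in[OF y(1)] by simp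
  have "N n ?w = N n (d' (n - 1) y)" using k y Nd'[OF y(1)] by simp
  then obtain z where z: "z \<in> C n" "?w - d' (n - 1) y = t n z" using N_eq_t[OF w y'] by blast
  have "d' n (?w - d' (n - 1) y) = t (n + 1) x" using dw d'd'[OF y(1)] by (simp add: d'.diff)
  then have "t (n + 1) x = t (n + 1) (d n z)" using z by (simp add: td)
  then have "x - d n z \<in> ZK (n + 1)"
    using x z by (simp add: ZK_def K_def C_diff d_in d.diff t.diff dd)
  then show ?thesis using z by force
qed

text \<open>The cocycle \<open>x\<close> itself lies over \<open>d' (h t x) = t x\<close>, and \<open>d x = 0\<close>.\<close>

lemma periodicity_connecting:
  assumes "x \<in> Z (n + 1)" shows "periodicity n (connecting n x) \<in> d (n + 1) ` K (n + 1)"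
proof -
  have x: "x \<in> C (n + 1)" "d (n + 1) x = 0" using assms by (auto simp: Z_def)
  have "d' n (h n (t (n + 1) x)) = t (n + 1) x"
    using td[of x "n + 1"] x by (simp add: d'_h_cocycle t_in t.zero)
  then show ?thesis
    using periodicity_N[of "h n (t (n + 1) x)" n x] x by (simp add: connecting_def h_in t_in)
qed

text \<open>Lift \<open>x\<close> to \<open>y\<close> along \<open>N\<close> and \<open>d' y\<close> to \<open>z\<close> along \<open>t\<close>.  The hypothesis lets \<open>z\<close> be corrected by a cyclic
cochain so that it becomes a cocycle, and \<open>N h t z = N h d' y = x - d N h y\<close>.\<close>

lemma connecting_exact:
  assumes x: "x \<in> ZK n" and Sx: "periodicity n x \<in> d (n + 1) ` K (n + 1)"
  shows "\<exists>y\<in>Z (n + 1). x - connecting n y \<in> d (n - 1) ` K (n - 1)"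
proof -
  obtain y z where yz: "y \<in> C n" "N n y = x" "z \<in> C (n + 1)" "t (n + 1) z = d' n y"
    using lift_cocycle[OF x] .
  have "periodicity n x - (periodicity n x - d (n + 1) z) \<in> d (n + 1) ` K (n + 1)"
    using periodicity_N[OF yz(1,3,4)] yz(2) Sx subspace_diff[OF subspace_dK] by metis
  then obtain k where k: "k \<in> K (n + 1)" "d (n + 1) z = d (n + 1) k" by auto
  have u: "z - k \<in> Z (n + 1)" "t (n + 1) (z - k) = d' n y"
    using k yz by (auto simp: Z_def K_def C_diff d.diff t.diff)
  have y: "y \<in> C (n - 1 + 1)" "h (n - 1) y \<in> C (n - 1)" using yz(1) h_in[of y "n - 1"] by simp_all
  have "h n (d' n y) = y - d' (n - 1) (h (n - 1) y)"
    using contraction[OF y(1)] by (simp add: algebra_simps)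
  then have "connecting n (z - k) = x - d (n - 1) (N (n - 1) (h (n - 1) y))"
    using u yz Nd'[OF y(2)] by (simp add: connecting_def N.diff)
  then show ?thesis using u(1) y(2) N_K by (intro bexI[of _ "z - k"]) auto
qed

text \<open>If \<open>x = d y\<close> is cyclic, then \<open>d' (t y) = t x = 0\<close>, so \<open>y\<close> lies over \<open>d' (h t y)\<close> and \<open>w = N h t y\<close> is a
preimage of the class of \<open>x\<close>.\<close>

lemma periodicity_exact:
  assumes x: "x \<in> ZK (n + 2)" and ex: "x \<in> d (n + 1) ` C (n + 1)"
  shows "\<exists>w\<in>ZK n. x - periodicity n w \<in> d (n + 1) ` K (n + 1)"
proof -
  obtain y where y: "y \<in> C (n + 1)" "x = d (n + 1) y" using ex by auto
  let ?u = "h n (t (n + 1) y)"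
  have [simp]: "n + 1 + 1 = n + 2" by simp
  have "d' (n + 1) (t (n + 1) y) = 0"
    using td[OF y(1)] x y by (simp add: ZK_def K_def)
  then have u: "?u \<in> C n" "d' n ?u = t (n + 1) y" using y by (simp_all add: d'_h_cocycle h_in t_in)
  have "d n (N n ?u) = 0" using Nd'[OF u(1)] u y by (simp add: Nt)
  then have w: "N n ?u \<in> ZK n" using u by (simp add: ZK_def N_K)
  have "periodicity n (N n ?u) - x \<in> d (n + 1) ` K (n + 1)"
    using periodicity_N[OF u(1) y(1)] u y by simp
  then have "x - periodicity n (N n ?u) \<in> d (n + 1) ` K (n + 1)"
    using subspace_neg[OF subspace_dK] by (metis minus_diff_eq)
  with w show ?thesis by blast
qed

lemma periodicity_in_dC:
  assumes "x \<in> ZK n" shows "periodicity n x \<in> d (n + 1) ` C (n + 1)"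
proof -
  have "x \<in> C n" using assms by (simp add: ZK_def K_def)
  then show ?thesis by (auto simp: periodicity_def D_in d'_in E_in)
qed

theorem long_exact_sequence:
  fixes n :: int
  defines "I \<equiv> induced_map (\<lambda>x. x)"
    and "B \<equiv> induced_map (connecting (n - 1)) (d (n - 2) ` K (n - 2))"
    and "S \<equiv> induced_map (periodicity (n - 1)) (d n ` K n)"
  shows "quotient_linear scale (ZK n) (d (n - 1) ` K (n - 1)) (Z n) (d (n - 1) ` C (n - 1))
        (I (d (n - 1) ` C (n - 1)))" (is ?I)
    and "quotient_linear scale (Z n) (d (n - 1) ` C (n - 1)) (ZK (n - 1)) (d (n - 2) ` K (n - 2)) B" (is ?B)
    and "quotient_linear scale (ZK (n - 1)) (d (n - 2) ` K (n - 2)) (ZK (n + 1)) (d n ` K n) S" (is ?S)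
    and "I (d (n - 1) ` C (n - 1)) ` quotient_space (ZK n) (d (n - 1) ` K (n - 1))
       = {X \<in> quotient_space (Z n) (d (n - 1) ` C (n - 1)). B X = d (n - 2) ` K (n - 2)}" (is ?HH)
    and "B ` quotient_space (Z n) (d (n - 1) ` C (n - 1))
       = {X \<in> quotient_space (ZK (n - 1)) (d (n - 2) ` K (n - 2)). S X = d n ` K n}" (is ?HC)
    and "S ` quotient_space (ZK (n - 1)) (d (n - 2) ` K (n - 2))
       = {X \<in> quotient_space (ZK (n + 1)) (d n ` K n). I (d n ` C n) X = d n ` C n}" (is ?HC')
proof -
  obtain m where m: "n = m + 1" by (metis diff_add_cancel)
  obtain l where l: "m = l + 1" by (metis diff_add_cancel)
  have idx: "m + 1 - 1 = m" "m + 1 - 2 = m - 1" "m + 1 + 1 = m + 2" by simp_all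
  have sub: "d k ` K k \<subseteq> d k ` C k" for k using K_in by blast
  have dKm: "d (m - 1) ` K (m - 1) \<subseteq> ZK m" using dK_in_ZK[of "m - 1"] by simp
  have B1: "connecting m ` Z (m + 1) \<subseteq> ZK m" using connecting_Z by blast
  have B2: "connecting m ` d m ` C m \<subseteq> d (m - 1) ` K (m - 1)" using connecting_coboundary by blast
  have S1: "periodicity m ` ZK m \<subseteq> ZK (m + 2)" using periodicity_ZK by blast
  have S2: "periodicity m ` d (m - 1) ` K (m - 1) \<subseteq> d (m + 1) ` K (m + 1)"
    using periodicity_coboundary[of _ l] unfolding l by (auto simp: add.assoc)
  note W = subspace_dC subspace_dK
  note homs = module.module_hom_ident[OF module_axioms] hom_connecting hom_periodicity
  show ?I unfolding assms m idx
    by (rule quotient_linear_induced_map[OF homs(1) W(2,1)]) (use sub ZK_in_Z in simp_all)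
  show ?B unfolding assms m idx
    by (rule quotient_linear_induced_map[OF homs(2) W(1,2) B1 B2])
  show ?S unfolding assms m idx
    by (rule quotient_linear_induced_map[OF homs(3) W(2,2) S1 S2])
  show ?HH unfolding assms m idx
  proof (rule induced_map_exact[OF homs(1,2) W(2,1,2) subspace_Z dC_in_Z])
    show "connecting m x \<in> d (m - 1) ` K (m - 1)" if "x \<in> ZK (m + 1)" for x
      using that connecting_K subspace_0[OF subspace_dK] by (simp add: ZK_def)
  qed (use sub ZK_in_Z B2 inclusion_exact in simp_all)
  show ?HC unfolding assms m idx
    by (rule induced_map_exact[OF homs(2,3) W(1,2,2) subspace_ZK dKm B1 B2 S2])
      (use periodicity_connecting connecting_exact in auto)
  show ?HC' unfolding assms m idx
    by (rule induced_map_exact[OF homs(3,1) W(2,2,1) subspace_ZK dK_in_ZK2 S1 S2])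
      (use sub periodicity_in_dC periodicity_exact in auto)
qed

end

section \<open>Cocyclic modules\<close>

text \<open>A family indexed by natural numbers, extended by zero to negative degrees.\<close>

definition int_maps :: "(nat \<Rightarrow> 'v \<Rightarrow> 'v::zero) \<Rightarrow> int \<Rightarrow> 'v \<Rightarrow> 'v" where
  "int_maps f n = (if n < 0 then (\<lambda>_. 0) else f (nat n))"

definition int_spaces :: "(nat \<Rightarrow> 'v::zero set) \<Rightarrow> int \<Rightarrow> 'v set" where
  "int_spaces C n = (if n < 0 then {0} else C (nat n))"

lemma sum_lessThan_shift:
  "(\<Sum>j<m. f (Suc j)) = (\<Sum>j<m. f j) + f m - (f 0 :: 'v::ab_group_add)"
  by (induction m) (simp_all add: algebra_simps)

context vector_space
begin

text \<open>The substitution \<open>(j, i) \<mapsto> (i, j - 1)\<close> maps the terms with \<open>i < j\<close> to those with \<open>j \<le> i\<close> and reverses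
their sign.\<close>

lemma alternating_double_sum:
  fixes f :: "nat \<Rightarrow> nat \<Rightarrow> 'b"
  assumes "\<And>i j. i < j \<Longrightarrow> j \<le> Suc m \<Longrightarrow> f j i = f i (j - 1)"
  shows "(\<Sum>j\<le>Suc m. \<Sum>i\<le>m. scale ((-1) ^ j) (scale ((-1) ^ i) (f j i))) = 0"
proof -
  let ?g = "\<lambda>(j, i). scale ((-1) ^ (j + i)) (f j i)"
  let ?L = "{(j, i). i < j \<and> j \<le> Suc m}" and ?U = "{(j, i). j \<le> i \<and> i \<le> m}"
  have fin: "finite ?L" "finite ?U"
    by (rule finite_subset[of _ "{..Suc m} \<times> {..Suc m}"]; auto)+
  have "(\<Sum>p\<in>?U. - ?g p) = sum ?g ?L"
  proof (rule sum.reindex_bij_witness[of _ "\<lambda>(j, i). (i, j - 1)" "\<lambda>(i, k). (Suc k, i)"])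
    fix p assume "p \<in> ?U"
    then show "?g (case p of (i, k) \<Rightarrow> (Suc k, i)) = - ?g p"
      using assms[of "fst p" "Suc (snd p)"] by (auto simp: add.commute)
  qed auto
  moreover have "?L \<inter> ?U = {}" "?L \<union> ?U = {..Suc m} \<times> {..m}" by auto
  ultimately have "sum ?g ({..Suc m} \<times> {..m}) = 0"
    using sum.union_disjoint[OF fin, of ?g] by (simp add: sum_negf flip: \<open>(\<Sum>p\<in>?U. - ?g p) = sum ?g ?L\<close>)
  then show ?thesis by (simp add: sum.cartesian_product power_add)
qed

end

text \<open>A cocyclic module with cofaces \<open>\<delta>\<close>, rotation \<open>\<tau>\<close> and an extra codegeneracy \<open>\<sigma>\<close>.  Among the relations
between two cofaces only those that involve \<open>\<delta> n 0\<close> and avoid the last coface are postulated; the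
remaining ones are consequences of the relations with \<open>\<tau>\<close>.\<close>

locale cocyclic_module = vector_space scale
  for scale :: "'k::field_char_0 \<Rightarrow> 'v::ab_group_add \<Rightarrow> 'v" +
  fixes C :: "nat \<Rightarrow> 'v set"
    and \<delta> :: "nat \<Rightarrow> nat \<Rightarrow> 'v \<Rightarrow> 'v" and \<tau> \<sigma> :: "nat \<Rightarrow> 'v \<Rightarrow> 'v"
  assumes subspace_C: "subspace (C n)"
    and hom_\<delta>: "module_hom scale scale (\<delta> n i)"
    and hom_\<tau>: "module_hom scale scale (\<tau> n)" and hom_\<sigma>: "module_hom scale scale (\<sigma> n)"
    and \<delta>_in: "i \<le> Suc n \<Longrightarrow> x \<in> C n \<Longrightarrow> \<delta> n i x \<in> C (Suc n)"
    and \<tau>_in: "x \<in> C n \<Longrightarrow> \<tau> n x \<in> C n"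
    and \<sigma>_in: "y \<in> C (Suc n) \<Longrightarrow> \<sigma> n y \<in> C n"
    and \<tau>_cyclic: "x \<in> C n \<Longrightarrow> (\<tau> n ^^ Suc n) x = x"
    and \<tau>_\<delta>_0: "x \<in> C n \<Longrightarrow> \<tau> (Suc n) (\<delta> n 0 x) = \<delta> n (Suc n) x"
    and \<tau>_\<delta>_Suc: "i \<le> n \<Longrightarrow> x \<in> C n \<Longrightarrow> \<tau> (Suc n) (\<delta> n (Suc i) x) = \<delta> n i (\<tau> n x)"
    and \<delta>_\<delta>_0: "j \<le> n \<Longrightarrow> x \<in> C n \<Longrightarrow> \<delta> (Suc n) (Suc j) (\<delta> n 0 x) = \<delta> (Suc n) 0 (\<delta> n j x)"
    and \<sigma>_\<delta>_0: "x \<in> C n \<Longrightarrow> \<sigma> n (\<delta> n 0 x) = x"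
    and \<sigma>_\<delta>_Suc: "i \<le> n \<Longrightarrow> x \<in> C (Suc n) \<Longrightarrow> \<sigma> (Suc n) (\<delta> (Suc n) (Suc i) x) = \<delta> n i (\<sigma> n x)"
begin

sublocale \<delta>: module_hom scale scale "\<delta> n i" for n i by (rule hom_\<delta>)
sublocale \<tau>: module_hom scale scale "\<tau> n" for n by (rule hom_\<tau>)
sublocale \<sigma>: module_hom scale scale "\<sigma> n" for n by (rule hom_\<sigma>)

lemmas C_zero = subspace_0[OF subspace_C] and C_add = subspace_add[OF subspace_C]
  and C_diff = subspace_diff[OF subspace_C]
  and C_scale = subspace_scale[OF subspace_C] and C_sum = subspace_sum[OF subspace_C]

lemma \<tau>_inj:
  assumes "x \<in> C n" "y \<in> C n" "\<tau> n x = \<tau> n y" shows "x = y"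
proof -
  have "(\<tau> n ^^ Suc n) x = (\<tau> n ^^ Suc n) y"
    using assms(3) by (simp only: funpow_Suc_right o_apply)
  then show ?thesis using assms \<tau>_cyclic by metis
qed

text \<open>Since \<open>\<tau>\<close> is injective and lowers the index of a coface by one, the relation for \<open>(i + 1, j + 1)\<close> follows
from that for \<open>(i, j)\<close>.\<close>

lemma \<delta>_\<delta>:
  assumes "i < j" "j \<le> Suc (Suc n)" "x \<in> C n"
  shows "\<delta> (Suc n) j (\<delta> n i x) = \<delta> (Suc n) i (\<delta> n (j - 1) x)"
  using assms
proof (induction i arbitrary: j x)
  case 0
  then obtain k where k: "j = Suc k" "k \<le> Suc n" by (cases j) auto
  show ?case
  proof (cases "k \<le> n")
    case True
    then show ?thesis using 0 k by (simp add: \<delta>_\<delta>_0)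
  next
    case False
    with k have [simp]: "k = Suc n" by simp
    have "\<delta> (Suc n) (Suc (Suc n)) (\<delta> n 0 x) = \<tau> (Suc (Suc n)) (\<delta> (Suc n) 0 (\<delta> n 0 x))"
      using 0 by (simp add: \<tau>_\<delta>_0 \<delta>_in)
    also have "\<dots> = \<tau> (Suc (Suc n)) (\<delta> (Suc n) (Suc 0) (\<delta> n 0 x))"
      using 0 by (simp add: \<delta>_\<delta>_0)
    also have "\<dots> = \<delta> (Suc n) 0 (\<delta> n (Suc n) x)"
      using 0 by (simp add: \<tau>_\<delta>_Suc \<tau>_\<delta>_0 \<delta>_in)
    finally show ?thesis using k by simp
  qed
next
  case (Suc i)
  then obtain k where k: "j = Suc (Suc k)" "k \<le> n" "i \<le> k" by (cases j; cases "j - 1") auto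
  have "\<tau> (Suc (Suc n)) (\<delta> (Suc n) (Suc (Suc k)) (\<delta> n (Suc i) x))
      = \<delta> (Suc n) (Suc k) (\<delta> n i (\<tau> n x))"
    using Suc.prems k by (simp add: \<tau>_\<delta>_Suc \<delta>_in)
  also have "\<dots> = \<delta> (Suc n) i (\<delta> n k (\<tau> n x))"
    using Suc.IH[of "Suc k" "\<tau> n x"] Suc.prems k by (simp add: \<tau>_in)
  also have "\<dots> = \<tau> (Suc (Suc n)) (\<delta> (Suc n) (Suc i) (\<delta> n (Suc k) x))"
    using Suc.prems k by (simp add: \<tau>_\<delta>_Suc \<delta>_in)
  finally show ?case
    unfolding k(1) diff_Suc_1 by (rule \<tau>_inj[rotated 2]) (use Suc.prems k in \<open>simp_all add: \<delta>_in\<close>)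
qed

text \<open>With the signs absorbed in \<open>\<rho>\<close> and \<open>\<delta>s\<close>, the relations between rotation and cofaces are free of signs:
\<open>\<rho>\<close> maps \<open>\<delta>s n 0\<close> to the last coface and shifts all other indices down by one.

The sum in \<open>D\<close> is weighted by \<open>j\<close> because \<open>\<Sum> j (\<rho>\<^sup>j - \<rho>\<^sup>j\<^sup>+\<^sup>1) = N - (n + 1)\<close> on \<open>C n\<close>, by Abel summation;
so \<open>t\<close> undoes \<open>D\<close> on the kernel of \<open>N\<close>.\<close>

definition \<rho> :: "nat \<Rightarrow> 'v \<Rightarrow> 'v" where "\<rho> n x = scale ((-1) ^ n) (\<tau> n x)"
definition \<delta>s :: "nat \<Rightarrow> nat \<Rightarrow> 'v \<Rightarrow> 'v" where "\<delta>s n i x = scale ((-1) ^ i) (\<delta> n i x)"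
definition d :: "nat \<Rightarrow> 'v \<Rightarrow> 'v" where "d n x = (\<Sum>i\<le>Suc n. \<delta>s n i x)"
definition d' :: "nat \<Rightarrow> 'v \<Rightarrow> 'v" where "d' n x = (\<Sum>i\<le>n. \<delta>s n i x)"
definition t :: "nat \<Rightarrow> 'v \<Rightarrow> 'v" where "t n x = x - \<rho> n x"
definition N :: "nat \<Rightarrow> 'v \<Rightarrow> 'v" where "N n x = (\<Sum>j<Suc n. (\<rho> n ^^ j) x)"
definition D :: "nat \<Rightarrow> 'v \<Rightarrow> 'v" where
  "D n x = scale (- 1 / of_nat (Suc n)) (\<Sum>j<Suc n. scale (of_nat j) ((\<rho> n ^^ j) x))"
definition E :: "nat \<Rightarrow> 'v \<Rightarrow> 'v" where "E n x = scale (1 / of_nat (Suc n)) x"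

lemma hom_\<rho>: "module_hom scale scale (\<rho> n)"
  unfolding \<rho>_def by unfold_locales (simp_all add: \<tau>.add \<tau>.scale scale_right_distrib mult.commute)
sublocale \<rho>: module_hom scale scale "\<rho> n" for n by (rule hom_\<rho>)

lemma hom_\<delta>s: "module_hom scale scale (\<delta>s n i)"
  unfolding \<delta>s_def by unfold_locales (simp_all add: \<delta>.add \<delta>.scale scale_right_distrib mult.commute)
sublocale \<delta>s: module_hom scale scale "\<delta>s n i" for n i by (rule hom_\<delta>s)

lemma hom_\<rho>_power: "module_hom scale scale (\<rho> n ^^ j)"
  by (induction j) (unfold_locales, simp_all add: \<rho>.add \<rho>.scale module_hom.add module_hom.scale)
sublocale \<rho>_power: module_hom scale scale "\<rho> n ^^ j" for n j by (rule hom_\<rho>_power)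

lemmas hom_sum = module_pair.module_hom_sum[OF module_pair.intro[OF module_axioms module_axioms]
    _ conjI[OF module_axioms module_axioms]]
  and hom_diff = module_pair.module_hom_sub[OF module_pair.intro[OF module_axioms module_axioms]]
  and hom_scale = module_pair.module_hom_scale[OF module_pair.intro[OF module_axioms module_axioms]]
  and hom_zero = module_pair.module_hom_zero[OF module_pair.intro[OF module_axioms module_axioms]]
  and hom_ident = module.module_hom_ident[OF module_axioms]

lemma hom_sums:
  "module_hom scale scale (d n)" "module_hom scale scale (d' n)" "module_hom scale scale (t n)"
  "module_hom scale scale (N n)" "module_hom scale scale (D n)" "module_hom scale scale (E n)"
  unfolding d_def[abs_def] d'_def[abs_def] t_def[abs_def] N_def[abs_def] D_def[abs_def] E_def[abs_def]
  by (intro hom_scale hom_sum hom_diff hom_\<delta>s hom_\<rho> hom_\<rho>_power hom_ident)+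

lemma \<rho>_in: "x \<in> C n \<Longrightarrow> \<rho> n x \<in> C n" by (simp add: \<rho>_def C_scale \<tau>_in)
lemma \<rho>_power_in: "x \<in> C n \<Longrightarrow> (\<rho> n ^^ j) x \<in> C n" by (induction j) (simp_all add: \<rho>_in)
lemma \<delta>s_in: "i \<le> Suc n \<Longrightarrow> x \<in> C n \<Longrightarrow> \<delta>s n i x \<in> C (Suc n)" by (simp add: \<delta>s_def C_scale \<delta>_in)
lemma d_in: "x \<in> C n \<Longrightarrow> d n x \<in> C (Suc n)" by (auto simp: d_def \<delta>s_in simp del: sum.atMost_Suc intro!: C_sum)
lemma d'_in: "x \<in> C n \<Longrightarrow> d' n x \<in> C (Suc n)" by (auto simp: d'_def \<delta>s_in intro!: C_sum)
lemma t_in: "x \<in> C n \<Longrightarrow> t n x \<in> C n" by (simp add: t_def C_diff \<rho>_in)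
lemma N_in: "x \<in> C n \<Longrightarrow> N n x \<in> C n" by (simp add: N_def C_sum \<rho>_power_in del: sum.lessThan_Suc)
lemma D_in: "x \<in> C n \<Longrightarrow> D n x \<in> C n"
  unfolding D_def by (intro C_scale C_sum \<rho>_power_in)
lemma E_in: "x \<in> C n \<Longrightarrow> E n x \<in> C n" by (simp add: E_def C_scale)

lemma \<rho>_power: "(\<rho> n ^^ j) x = scale ((-1) ^ (n * j)) ((\<tau> n ^^ j) x)"
  by (induction j) (simp_all add: \<rho>_def \<tau>.scale power_add)

lemma \<rho>_cyclic: "x \<in> C n \<Longrightarrow> (\<rho> n ^^ Suc n) x = x"
  unfolding \<rho>_power using \<tau>_cyclic[of x n] by (simp del: funpow.simps)

lemma \<rho>_\<delta>s_0: "x \<in> C n \<Longrightarrow> \<rho> (Suc n) (\<delta>s n 0 x) = \<delta>s n (Suc n) x"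
  by (simp add: \<rho>_def \<delta>s_def \<tau>_\<delta>_0)

lemma \<rho>_\<delta>s_Suc: "i \<le> n \<Longrightarrow> x \<in> C n \<Longrightarrow> \<rho> (Suc n) (\<delta>s n (Suc i) x) = \<delta>s n i (\<rho> n x)"
  by (simp add: \<rho>_def \<delta>s_def \<tau>.scale \<tau>.neg \<delta>.scale \<tau>_\<delta>_Suc mult.commute)

lemma N_\<rho>: "x \<in> C n \<Longrightarrow> N n (\<rho> n x) = N n x"
  using sum_lessThan_shift[of "\<lambda>j. (\<rho> n ^^ j) x" "Suc n"] \<rho>_cyclic[of x n]
  by (simp add: N_def funpow_swap1 del: sum.lessThan_Suc)

lemma \<rho>_N: "x \<in> C n \<Longrightarrow> \<rho> n (N n x) = N n x"
  using sum_lessThan_shift[of "\<lambda>j. (\<rho> n ^^ j) x" "Suc n"] \<rho>_cyclic[of x n]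
  by (simp add: N_def \<rho>.sum del: sum.lessThan_Suc)

lemma dd: "x \<in> C n \<Longrightarrow> d (Suc n) (d n x) = 0"
  using alternating_double_sum[of "Suc n" "\<lambda>j i. \<delta> (Suc n) j (\<delta> n i x)"] \<delta>_\<delta>[of _ _ n x]
  by (simp add: d_def \<delta>s_def \<delta>.sum \<delta>.scale scale_sum_right del: sum.atMost_Suc)

lemma d'd': "x \<in> C n \<Longrightarrow> d' (Suc n) (d' n x) = 0"
  using alternating_double_sum[of n "\<lambda>j i. \<delta> (Suc n) j (\<delta> n i x)"] \<delta>_\<delta>[of _ _ n x]
  by (simp add: d'_def \<delta>s_def \<delta>.sum \<delta>.scale scale_sum_right del: sum.atMost_Suc)

text \<open>Moving \<open>\<rho>\<close> through \<open>d\<close> turns the zeroth coface into the last one and the others into \<open>d'\<close>; the last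
coface then cancels in \<open>d - \<rho> d\<close>.\<close>

lemma td:
  assumes x: "x \<in> C n" shows "t (Suc n) (d n x) = d' n (t n x)"
proof -
  have "\<rho> (Suc n) (d n x) = \<delta>s n (Suc n) x + d' n (\<rho> n x)"
    using x by (simp add: d_def d'_def sum.atMost_Suc_shift \<rho>.add \<rho>.sum \<rho>_\<delta>s_0 \<rho>_\<delta>s_Suc
        del: sum.atMost_Suc)
  moreover have "d n x = d' n x + \<delta>s n (Suc n) x" by (simp add: d_def d'_def)
  ultimately show ?thesis
    using module_hom.diff[OF hom_sums(2)] by (simp add: t_def)
qed

text \<open>As \<open>N\<close> absorbs \<open>\<rho>\<close>, every coface but \<open>\<delta>s n 0\<close> can be rotated away behind \<open>N\<close>.\<close>

lemma N_\<delta>s: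
  assumes "i \<le> Suc n" "x \<in> C n"
  shows "N (Suc n) (\<delta>s n i x) = N (Suc n) (\<delta>s n 0 ((\<rho> n ^^ i) x))"
  using assms
proof (induction i arbitrary: x)
  case (Suc i)
  have "N (Suc n) (\<delta>s n (Suc i) x) = N (Suc n) (\<delta>s n i (\<rho> n x))"
    using Suc.prems N_\<rho>[of "\<delta>s n (Suc i) x" "Suc n"] by (simp add: \<rho>_\<delta>s_Suc \<delta>s_in)
  then show ?case using Suc by (simp add: \<rho>_in funpow_swap1)
qed simp

text \<open>On an invariant element the cofaces are the powers of \<open>\<rho>\<close> applied to the zeroth one, from the last
coface downwards.\<close>

lemma \<delta>s_invariant:
  assumes y: "y \<in> C n" "\<rho> n y = y" and k: "k \<le> Suc n"
  shows "\<delta>s n (Suc n - k) y = (\<rho> (Suc n) ^^ Suc k) (\<delta>s n 0 y)"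
  using k
proof (induction k)
  case (Suc k)
  then have "\<rho> (Suc n) (\<delta>s n (Suc n - k) y) = \<delta>s n (Suc n - Suc k) y"
    using \<rho>_\<delta>s_Suc[of "n - k" n y] y by (simp add: Suc_diff_le)
  then show ?case using Suc by simp
qed (simp add: \<rho>_\<delta>s_0 y)

text \<open>Both sides equal \<open>N (\<delta>s n 0 (N x))\<close>: on the left the \<open>n + 1\<close> cofaces of \<open>d'\<close> contribute the \<open>n + 1\<close>
powers of \<open>\<rho>\<close> in the inner norm, on the right the \<open>n + 2\<close> cofaces of \<open>d\<close> contribute the powers in the
outer norm.\<close>

lemma Nd':
  assumes x: "x \<in> C n" shows "N (Suc n) (d' n x) = d n (N n x)"
proof -
  have "N (Suc n) (d' n x) = (\<Sum>i\<le>n. N (Suc n) (\<delta>s n 0 ((\<rho> n ^^ i) x)))"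
    using x by (simp add: d'_def module_hom.sum[OF hom_sums(4)] N_\<delta>s)
  also have "\<dots> = N (Suc n) (\<delta>s n 0 (N n x))"
    by (simp only: N_def[of n] \<delta>s.sum module_hom.sum[OF hom_sums(4)] lessThan_Suc_atMost)
  also have "\<dots> = \<rho> (Suc n) (N (Suc n) (\<delta>s n 0 (N n x)))"
    using x by (simp add: \<rho>_N \<delta>s_in N_in)
  also have "\<dots> = (\<Sum>k<Suc (Suc n). (\<rho> (Suc n) ^^ Suc k) (\<delta>s n 0 (N n x)))"
    by (simp only: N_def[of "Suc n"] \<rho>.sum funpow.simps o_apply)
  also have "\<dots> = (\<Sum>k<Suc (Suc n). \<delta>s n (Suc (Suc n) - Suc k) (N n x))"
    using x \<delta>s_invariant[of "N n x" n] by (intro sum.cong) (auto simp: N_in \<rho>_N)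
  also have "\<dots> = d n (N n x)"
    unfolding d_def lessThan_Suc_atMost[symmetric]
    by (rule sum.nat_diff_reindex[of "\<lambda>i. \<delta>s n i (N n x)"])
  finally show ?thesis .
qed

lemma Nt: "x \<in> C n \<Longrightarrow> N n (t n x) = 0"
  by (simp add: t_def module_hom.diff[OF hom_sums(4)] N_\<rho>)

lemma tN: "x \<in> C n \<Longrightarrow> t n (N n x) = 0"
  by (simp add: t_def \<rho>_N)

lemma NE: "x \<in> C n \<Longrightarrow> t n x = 0 \<Longrightarrow> N n (E n x) = x"
proof -
  assume x: "x \<in> C n" "t n x = 0"
  then have "(\<rho> n ^^ j) x = x" for j by (induction j) (simp_all add: t_def)
  then have "N n x = scale (of_nat (Suc n)) x"
    by (simp add: N_def sum_constant_scale del: sum.lessThan_Suc of_nat_Suc)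
  then show ?thesis
    by (simp add: E_def module_hom.scale[OF hom_sums(4)] del: of_nat_Suc)
qed

lemma tD:
  assumes x: "x \<in> C n" "N n x = 0" shows "t n (D n x) = x"
proof -
  let ?f = "\<lambda>j. scale (of_nat j) ((\<rho> n ^^ j) x)"
  let ?W = "\<Sum>j<Suc n. ?f j"
  have "\<rho> n ?W = (\<Sum>j<Suc n. ?f (Suc j) - (\<rho> n ^^ Suc j) x)"
    by (simp add: \<rho>.sum \<rho>.scale scale_left_distrib del: sum.lessThan_Suc)
  also have "\<dots> = (\<Sum>j<Suc n. ?f (Suc j)) - N n (\<rho> n x)"
    by (simp only: sum_subtractf N_def funpow_Suc_right o_apply)
  also have "\<dots> = ?W + scale (of_nat (Suc n)) x"
    using sum_lessThan_shift[of ?f "Suc n"] x \<rho>_cyclic[of x n]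
    by (simp add: N_\<rho> del: sum.lessThan_Suc of_nat_Suc funpow.simps)
  finally have "\<rho> n ?W = ?W + scale (of_nat (Suc n)) x" .
  then show ?thesis
    by (simp add: t_def D_def \<rho>.scale \<rho>.neg scale_right_distrib del: of_nat_Suc sum.lessThan_Suc)
qed

text \<open>The codegeneracy cancels the zeroth coface and lowers the index of the others by one; the two shifted
sums have opposite signs.\<close>

lemma contraction:
  assumes x: "x \<in> C (Suc n)" shows "\<sigma> (Suc n) (d' (Suc n) x) + d' n (\<sigma> n x) = x"
  using x by (simp add: d'_def \<delta>s_def sum.atMost_Suc_shift \<sigma>.add \<sigma>.diff \<sigma>.sum \<sigma>.scale \<sigma>.neg \<sigma>_\<delta>_0 \<sigma>_\<delta>_Suc
      sum_negf del: sum.atMost_Suc)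

lemma contraction_0: "x \<in> C 0 \<Longrightarrow> \<sigma> 0 (d' 0 x) = x"
  by (simp add: d'_def \<delta>s_def \<sigma>_\<delta>_0)

lemma module_hom_int_maps:
  "(\<And>n. module_hom scale scale (f n)) \<Longrightarrow> module_hom scale scale (int_maps f n)"
  by (simp add: int_maps_def hom_zero)

lemma int_maps_nat [simp]: "int_maps f (int n) = f n"
  by (simp add: int_maps_def)

lemma int_spaces_nat [simp]: "int_spaces C (int n) = C n"
  by (simp add: int_spaces_def)

lemma int_maps_Suc [simp]: "int_maps f (int n + 1) = f (Suc n)"
  by (simp add: int_maps_def nat_add_distrib)

lemma int_spaces_Suc [simp]: "int_spaces C (int n + 1) = C (Suc n)"
  by (simp add: int_spaces_def nat_add_distrib)

lemma int_maps_in: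
  "(\<And>m y. y \<in> C m \<Longrightarrow> f m y \<in> C m) \<Longrightarrow> x \<in> int_spaces C n \<Longrightarrow> int_maps f n x \<in> int_spaces C n"
  by (auto simp: int_maps_def int_spaces_def split: if_splits)

lemma int_maps_in_Suc:
  "(\<And>m y. y \<in> C m \<Longrightarrow> f m y \<in> C (Suc m)) \<Longrightarrow> x \<in> int_spaces C n \<Longrightarrow>
     int_maps f n x \<in> int_spaces C (n + 1)"
  by (auto simp: int_maps_def int_spaces_def nat_add_distrib C_zero split: if_splits)

lemma periodic_bicomplex:
  "periodic_bicomplex scale (int_spaces C) (int_maps d) (int_maps d') (int_maps \<sigma>)
     (int_maps t) (int_maps N) (int_maps D) (int_maps E)"
proof (intro periodic_bicomplex.intro vector_space_axioms periodic_bicomplex_axioms.intro)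
  show "subspace (int_spaces C n)" for n
    by (simp add: int_spaces_def subspace_C)
  fix n :: int and x
  show "module_hom scale scale (int_maps d n)" "module_hom scale scale (int_maps d' n)"
    "module_hom scale scale (int_maps \<sigma> n)" "module_hom scale scale (int_maps t n)"
    "module_hom scale scale (int_maps N n)" "module_hom scale scale (int_maps D n)"
    "module_hom scale scale (int_maps E n)"
    by (intro module_hom_int_maps hom_sums hom_\<sigma>)+
  \<comment> \<open>In degree \<open>-1\<close> the contraction identity concerns \<open>C 0\<close> and has only one nonzero summand.\<close>
  consider m where "n = int m" | "n = -1" | "n < -1"
    by (cases "n \<ge> 0"; cases "n = -1") (force elim: nonneg_int_cases)+
  note n_cases = this
  show "int_maps \<sigma> n x \<in> int_spaces C n" if "x \<in> int_spaces C (n + 1)"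
    using n_cases by cases (use that \<sigma>_in in \<open>simp_all add: int_maps_def int_spaces_def nat_add_distrib\<close>)
  show "int_maps \<sigma> (n + 1) (int_maps d' (n + 1) x) + int_maps d' n (int_maps \<sigma> n x) = x"
    if "x \<in> int_spaces C (n + 1)"
    using n_cases
    by cases (use that contraction contraction_0 in \<open>simp_all add: int_maps_def int_spaces_def nat_add_distrib\<close>)
  assume x: "x \<in> int_spaces C n"
  consider m where "n = int m" "x \<in> C m" | "n < 0" "x = 0"
    using x by (cases n rule: int_cases) (auto simp: int_spaces_def)
  note n_cases = this
  show "int_maps d n x \<in> int_spaces C (n + 1)" "int_maps d' n x \<in> int_spaces C (n + 1)"
    using int_maps_in_Suc[of d] int_maps_in_Suc[of d'] d_in d'_in x by blast+
  show "int_maps t n x \<in> int_spaces C n" "int_maps N n x \<in> int_spaces C n"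
    "int_maps D n x \<in> int_spaces C n" "int_maps E n x \<in> int_spaces C n"
    using int_maps_in[of t] int_maps_in[of N] int_maps_in[of D] int_maps_in[of E]
      t_in N_in D_in E_in x by blast+
  have "int_maps d (n + 1) (int_maps d n x) = 0 \<and> int_maps d' (n + 1) (int_maps d' n x) = 0 \<and>
    int_maps t (n + 1) (int_maps d n x) = int_maps d' n (int_maps t n x) \<and>
    int_maps N (n + 1) (int_maps d' n x) = int_maps d n (int_maps N n x) \<and>
    int_maps N n (int_maps t n x) = 0 \<and> int_maps t n (int_maps N n x) = 0"
    using n_cases
    by cases (simp_all add: dd d'd' td Nd' Nt tN int_maps_def nat_add_distrib hom_sums[THEN module_hom.zero])
  then show "int_maps d (n + 1) (int_maps d n x) = 0" "int_maps d' (n + 1) (int_maps d' n x) = 0"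
    "int_maps t (n + 1) (int_maps d n x) = int_maps d' n (int_maps t n x)"
    "int_maps N (n + 1) (int_maps d' n x) = int_maps d n (int_maps N n x)"
    "int_maps N n (int_maps t n x) = 0" "int_maps t n (int_maps N n x) = 0"
    by blast+
  show "int_maps t n (int_maps D n x) = x" if "int_maps N n x = 0"
    using n_cases that by cases (auto simp: tD int_maps_def)
  show "int_maps N n (int_maps E n x) = x" if "int_maps t n x = 0"
    using n_cases that by cases (auto simp: NE int_maps_def)
qed

end

section \<open>Maps between the tensor products\<close>

lemma lookup_free_scale [simp]:
  "Poly_Mapping.lookup (free_scale c f) x = c * Poly_Mapping.lookup f x"
  by (simp add: free_scale_def map.rep_eq when_def)

lemma free_scale_single [simp]:
  "free_scale c (Poly_Mapping.single x a) = Poly_Mapping.single x (c * a)"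
  by (simp add: free_scale_def)

lemma vector_space_free_scale: "vector_space (free_scale :: 'k::field \<Rightarrow> _)"
  by unfold_locales
    (auto intro!: poly_mapping_eqI simp: lookup_add algebra_simps)

interpretation free: vector_space "free_scale :: 'k::field \<Rightarrow> ('x \<Rightarrow>\<^sub>0 'k) \<Rightarrow> ('x \<Rightarrow>\<^sub>0 'k)"
  by (rule vector_space_free_scale)

lemma module_hom_free_map:
  "module_hom (free_scale :: 'k::field \<Rightarrow> _) free_scale (free_map g)"
proof (rule module_hom.intro[OF free.module_axioms free.module_axioms module_hom_axioms.intro])
  fix f f' :: "'a \<Rightarrow>\<^sub>0 'k" and c :: 'k
  show "free_map g (f + f') = free_map g f + free_map g f'"
    unfolding free_map_def by (rule setsum_keys_plus_distrib) (simp_all add: single_add)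
  have "Poly_Mapping.keys (free_scale c f) = (if c = 0 then {} else Poly_Mapping.keys f)"
    by (auto simp: in_keys_iff)
  then show "free_map g (free_scale c f) = free_scale c (free_map g f)"
    by (simp add: free_map_def free.scale_sum_right)
qed

lemma free_map_single [simp]:
  "free_map g (Poly_Mapping.single x c) = Poly_Mapping.single (g x) c"
  by (simp add: free_map_def)

lemma free_map_comp: "free_map g (free_map h f) = free_map (g \<circ> h) f"
  unfolding free_map_def[of h f] free_map_def[of "g \<circ> h" f]
  by (simp only: module_hom.sum[OF module_hom_free_map] free_map_single o_apply)

lemma free_map_cong:
  "(\<And>x. x \<in> Poly_Mapping.keys f \<Longrightarrow> g x = h x) \<Longrightarrow> free_map g f = free_map h f"
  unfolding free_map_def by (intro sum.cong) simp_all

lemma free_map_ident: "free_map (\<lambda>x. x) f = f"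
  by (rule poly_mapping_eqI)
    (auto simp: free_map_def lookup_sum lookup_single when_def in_keys_iff)

lemma keys_free_map: "Poly_Mapping.keys (free_map g f) \<subseteq> g ` Poly_Mapping.keys f"
  unfolding free_map_def
  by (rule order_trans[OF keys_sum]) auto

lemma free_map_in_free_arrays:
  assumes "g ` arrays m \<subseteq> arrays n" "f \<in> free_arrays m"
  shows "free_map g f \<in> free_arrays n"
  using assms keys_free_map[of g f] unfolding free_arrays_def by blast

lemma subspace_free_arrays:
  "free.subspace (free_arrays n :: (('a, 'b) array \<Rightarrow>\<^sub>0 'k::field) set)"
proof (rule free.subspaceI)
  fix f f' :: "('a, 'b) array \<Rightarrow>\<^sub>0 'k" and c :: 'k
  show "f \<in> free_arrays n \<Longrightarrow> f' \<in> free_arrays n \<Longrightarrow> f + f' \<in> free_arrays n"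
    unfolding free_arrays_def using keys_add[of f f'] by blast
  show "f \<in> free_arrays n \<Longrightarrow> free_scale c f \<in> free_arrays n"
    by (auto simp: free_arrays_def in_keys_iff subset_iff)
qed (simp add: free_arrays_def)

context
  fixes scA :: "'k::field \<Rightarrow> 'a::ab_group_add \<Rightarrow> 'a" and scB :: "'k \<Rightarrow> 'b::ab_group_add \<Rightarrow> 'b"
begin

lemma subspace_tensor_rel: "free.subspace (tensor_rel scA scB n)"
  unfolding tensor_rel_def by (rule free.subspace_span)

lemma arrays_update:
  assumes "x \<in> arrays n"
  shows "l \<le> n \<Longrightarrow> apfst (\<lambda>a. a(l := z)) x \<in> arrays n"
    and "e \<in> upper n \<Longrightarrow> apsnd (\<lambda>b. b(e := w)) x \<in> arrays n"
  using assms by (auto simp: arrays_def PiE_iff extensional_def)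

text \<open>Updating an entry of an array within its index set gives an array, so no relation involves anything else;
thus maps that agree on arrays induce the same map.\<close>

lemma tensor_rel_subset: "tensor_rel scA scB n \<subseteq> free_arrays n"
  unfolding tensor_rel_def
proof (rule free.span_minimal[OF _ subspace_free_arrays])
  have gen: "Poly_Mapping.single x c \<in> free_arrays n" if "x \<in> arrays n" for x :: "('a, 'b) array" and c :: 'k
    using that by (simp add: free_arrays_def)
  have upd: "(a(l := z), b) \<in> arrays n" if "(a, b) \<in> arrays n" "l \<le> n"
    for a :: "nat \<Rightarrow> 'a" and b :: "nat \<times> nat \<Rightarrow> 'b" and l z
    using arrays_update(1)[OF that] by simp
  have upd': "(a, b(e := z)) \<in> arrays n" if "(a, b) \<in> arrays n" "e \<in> upper n"
    for a :: "nat \<Rightarrow> 'a" and b :: "nat \<times> nat \<Rightarrow> 'b" and e z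
    using arrays_update(2)[OF that] by simp
  show "multilinearity_gens scA scB n \<subseteq> free_arrays n"
    unfolding multilinearity_gens_def
    by (intro Un_least subsetI; elim CollectE exE conjE; hypsubst;
        intro free.subspace_diff[OF subspace_free_arrays] gen upd upd')
qed

text \<open>Maps of arrays that induce a linear map between the tensor products.\<close>

definition tensor_map :: "nat \<Rightarrow> nat \<Rightarrow> (('a, 'b) array \<Rightarrow> ('a, 'b) array) \<Rightarrow> bool" where
  "tensor_map m n g \<longleftrightarrow> g ` arrays m \<subseteq> arrays n \<and>
     free_map g ` tensor_rel scA scB m \<subseteq> tensor_rel scA scB n"

text \<open>If changing one entry of an array changes only one entry of its image, and that linearly, then a
multilinearity relation goes to a multilinearity relation.  An entry above the diagonal may also move
to the diagonal: this happens to the entry between two merged indices.\<close>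

lemma tensor_mapI:
  assumes closed: "\<And>x. x \<in> arrays m \<Longrightarrow> g x \<in> arrays n"
    and diagonal: "\<And>x l. x \<in> arrays m \<Longrightarrow> l \<le> m \<Longrightarrow>
      \<exists>l' L. l' \<le> n \<and> module_hom scA scA L \<and>
        (\<forall>z. g (apfst (\<lambda>a. a(l := z)) x) = apfst (\<lambda>a. a(l' := L z)) (g x))"
    and above: "\<And>x e. x \<in> arrays m \<Longrightarrow> e \<in> upper m \<Longrightarrow>
      (\<exists>l' L. l' \<le> n \<and> module_hom scB scA L \<and>
        (\<forall>z. g (apsnd (\<lambda>b. b(e := z)) x) = apfst (\<lambda>a. a(l' := L z)) (g x))) \<or>
      (\<exists>e' L. e' \<in> upper n \<and> module_hom scB scB L \<and>
        (\<forall>z. g (apsnd (\<lambda>b. b(e := z)) x) = apsnd (\<lambda>b. b(e' := L z)) (g x)))"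
  shows "tensor_map m n g"
proof -
  interpret free_map: module_hom "free_scale :: 'k \<Rightarrow> _" free_scale "free_map g"
    by (rule module_hom_free_map)
  let ?gen = "multilinearity_gens scA scB n"
  have rel: "f \<in> ?gen \<Longrightarrow> f \<in> tensor_rel scA scB n" for f
    unfolding tensor_rel_def by (rule free.span_base)
  have diag_add: "Poly_Mapping.single (apfst (\<lambda>a. a(l := u + v)) y) 1 - Poly_Mapping.single (apfst (\<lambda>a. a(l := u)) y) 1
      - Poly_Mapping.single (apfst (\<lambda>a. a(l := v)) y) 1 \<in> ?gen"
    if "y \<in> arrays n" "l \<le> n" for y l u v
    using that unfolding multilinearity_gens_def by (cases y, simp only: apfst_conv apsnd_conv) blast
  have diag_scale: "Poly_Mapping.single (apfst (\<lambda>a. a(l := scA c u)) y) 1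
      - Poly_Mapping.single (apfst (\<lambda>a. a(l := u)) y) c \<in> ?gen"
    if "y \<in> arrays n" "l \<le> n" for y l u c
    using that unfolding multilinearity_gens_def by (cases y, simp only: apfst_conv apsnd_conv) blast
  have above_add: "Poly_Mapping.single (apsnd (\<lambda>b. b(e := u + v)) y) 1 - Poly_Mapping.single (apsnd (\<lambda>b. b(e := u)) y) 1
      - Poly_Mapping.single (apsnd (\<lambda>b. b(e := v)) y) 1 \<in> ?gen"
    if "y \<in> arrays n" "e \<in> upper n" for y e u v
    using that unfolding multilinearity_gens_def by (cases y, simp only: apfst_conv apsnd_conv) blast
  have above_scale: "Poly_Mapping.single (apsnd (\<lambda>b. b(e := scB c u)) y) 1
      - Poly_Mapping.single (apsnd (\<lambda>b. b(e := u)) y) c \<in> ?gen"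
    if "y \<in> arrays n" "e \<in> upper n" for y e u c
    using that unfolding multilinearity_gens_def by (cases y, simp only: apfst_conv apsnd_conv) blast
  note hom = free_map.diff free_map_single
  have "free_map g f \<in> tensor_rel scA scB n" if "f \<in> multilinearity_gens scA scB m" for f
    using that unfolding multilinearity_gens_def
  proof (elim UnE CollectE exE conjE)
    fix a b l x y
    assume *: "f = Poly_Mapping.single (a(l := x + y), b) 1
      - Poly_Mapping.single (a(l := x), b) 1 - Poly_Mapping.single (a(l := y), b) 1"
      "(a, b) \<in> arrays m" "l \<le> m"
    obtain l' L where L: "l' \<le> n" "module_hom scA scA L"
      "\<And>z. g (apfst (\<lambda>a. a(l := z)) (a, b)) = apfst (\<lambda>a. a(l' := L z)) (g (a, b))"
      using diagonal[OF *(2,3)] by blast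
    then show ?thesis
      using diag_add[OF closed[OF *(2)] L(1)] by (simp add: *(1) hom rel module_hom.add)
  next
    fix a b l c x
    assume *: "f = Poly_Mapping.single (a(l := scA c x), b) 1 - Poly_Mapping.single (a(l := x), b) c"
      "(a, b) \<in> arrays m" "l \<le> m"
    obtain l' L where L: "l' \<le> n" "module_hom scA scA L"
      "\<And>z. g (apfst (\<lambda>a. a(l := z)) (a, b)) = apfst (\<lambda>a. a(l' := L z)) (g (a, b))"
      using diagonal[OF *(2,3)] by blast
    then show ?thesis
      using diag_scale[OF closed[OF *(2)] L(1)] by (simp add: *(1) hom rel module_hom.scale)
  next
    fix a b e x y
    assume *: "f = Poly_Mapping.single (a, b(e := x + y)) 1
      - Poly_Mapping.single (a, b(e := x)) 1 - Poly_Mapping.single (a, b(e := y)) 1"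
      "(a, b) \<in> arrays m" "e \<in> upper m"
    from above[OF *(2,3)] show ?thesis
    proof (elim disjE exE conjE)
      fix l' L assume L: "l' \<le> n" "module_hom scB scA L"
        "\<forall>z. g (apsnd (\<lambda>b. b(e := z)) (a, b)) = apfst (\<lambda>a. a(l' := L z)) (g (a, b))"
      then show ?thesis
        using diag_add[OF closed[OF *(2)] L(1)] by (simp add: *(1) hom rel module_hom.add)
    next
      fix e' L assume L: "e' \<in> upper n" "module_hom scB scB L"
        "\<forall>z. g (apsnd (\<lambda>b. b(e := z)) (a, b)) = apsnd (\<lambda>b. b(e' := L z)) (g (a, b))"
      then show ?thesis
        using above_add[OF closed[OF *(2)] L(1)] by (simp add: *(1) hom rel module_hom.add)
    qed
  next
    fix a b e c x
    assume *: "f = Poly_Mapping.single (a, b(e := scB c x)) 1 - Poly_Mapping.single (a, b(e := x)) c"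
      "(a, b) \<in> arrays m" "e \<in> upper m"
    from above[OF *(2,3)] show ?thesis
    proof (elim disjE exE conjE)
      fix l' L assume L: "l' \<le> n" "module_hom scB scA L"
        "\<forall>z. g (apsnd (\<lambda>b. b(e := z)) (a, b)) = apfst (\<lambda>a. a(l' := L z)) (g (a, b))"
      then show ?thesis
        using diag_scale[OF closed[OF *(2)] L(1)] by (simp add: *(1) hom rel module_hom.scale)
    next
      fix e' L assume L: "e' \<in> upper n" "module_hom scB scB L"
        "\<forall>z. g (apsnd (\<lambda>b. b(e := z)) (a, b)) = apsnd (\<lambda>b. b(e' := L z)) (g (a, b))"
      then show ?thesis
        using above_scale[OF closed[OF *(2)] L(1)] by (simp add: *(1) hom rel module_hom.scale)
    qed
  qed
  then have "free.span (free_map g ` multilinearity_gens scA scB m) \<subseteq> tensor_rel scA scB n"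
    by (intro free.span_minimal subspace_tensor_rel) blast
  then have "free_map g ` tensor_rel scA scB m \<subseteq> tensor_rel scA scB n"
    by (simp add: tensor_rel_def free_map.span_image)
  with closed show ?thesis by (auto simp: tensor_map_def)
qed

lemma tensor_map_comp:
  assumes "tensor_map l m h" "tensor_map m n g" shows "tensor_map l n (g \<circ> h)"
  using assms unfolding tensor_map_def by (auto simp: free_map_comp[symmetric] image_subset_iff)

lemma tensor_map_cong:
  assumes "\<And>x. x \<in> arrays m \<Longrightarrow> g x = h x" "tensor_map m n g"
  shows "tensor_map m n h"
proof -
  have "free_map g f = free_map h f" if "f \<in> tensor_rel scA scB m" for f
    using that tensor_rel_subset[of m] assms(1)
    by (intro free_map_cong) (unfold free_arrays_def, blast)
  then show ?thesis using assms by (auto simp: tensor_map_def)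
qed

lemma tensor_map_ident: "tensor_map n n (\<lambda>x. x)"
  by (auto simp: tensor_map_def free_map_ident)

lemma tensor_map_funpow: "tensor_map n n g \<Longrightarrow> tensor_map n n (g ^^ j)"
  by (induction j) (auto intro: tensor_map_comp simp: tensor_map_ident id_def)

end

section \<open>Identities between operations on arrays\<close>

lemma array_eqI:
  assumes "x \<in> arrays n" "y \<in> arrays n"
    and "\<And>l. l \<le> n \<Longrightarrow> fst x l = fst y l"
    and "\<And>u v. u < v \<Longrightarrow> v \<le> n \<Longrightarrow> snd x (u, v) = snd y (u, v)"
  shows "x = y"
proof (rule prod_eqI)
  show "fst x = fst y"
    by (rule PiE_ext[of _ "{..n}" "\<lambda>_. UNIV"]) (use assms in \<open>auto simp: arrays_def\<close>)
  show "snd x = snd y"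
  proof (rule PiE_ext[of _ "upper n" "\<lambda>_. UNIV"])
    show "snd x e = snd y e" if "e \<in> upper n" for e
      using that assms(4) by (auto simp: upper_def)
  qed (use assms(1,2) in \<open>auto simp: arrays_def\<close>)
qed

text \<open>Inserts a new index \<open>0\<close> whose row consists of units; it induces the extra degeneracy.\<close>

definition array_prepend :: "nat \<Rightarrow> ('a::one, 'b::one) array \<Rightarrow> ('a, 'b) array" where
  "array_prepend n = (\<lambda>(a, b).
     (\<lambda>l\<in>{..Suc n}. if l = 0 then 1 else a (l - 1),
      \<lambda>(u, v)\<in>upper (Suc n). if u = 0 then 1 else b (u - 1, v - 1)))"

lemma array_face_in: "array_face eps n i x \<in> arrays n"
  by (cases x) (auto simp: array_face_def arrays_def)

lemma array_rotate_in: "array_rotate n x \<in> arrays n"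
  by (cases x) (auto simp: array_rotate_def arrays_def)

lemma array_prepend_in: "array_prepend n x \<in> arrays (Suc n)"
  by (cases x) (auto simp: array_prepend_def arrays_def)

lemmas array_ops_in_arrays = array_face_in array_rotate_in array_prepend_in

lemma fst_rotate: "l \<le> n \<Longrightarrow> fst (array_rotate n x) l = (if l = 0 then fst x n else fst x (l - 1))"
  by (cases x) (simp add: array_rotate_def)

lemma snd_rotate:
  "u < v \<Longrightarrow> v \<le> n \<Longrightarrow>
     snd (array_rotate n x) (u, v) = (if u = 0 then snd x (v - 1, n) else snd x (u - 1, v - 1))"
  by (cases x) (simp add: array_rotate_def upper_def)

lemma fst_prepend: "l \<le> Suc n \<Longrightarrow> fst (array_prepend n x) l = (if l = 0 then 1 else fst x (l - 1))"
  by (cases x) (simp add: array_prepend_def)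

lemma snd_prepend:
  "u < v \<Longrightarrow> v \<le> Suc n \<Longrightarrow>
     snd (array_prepend n x) (u, v) = (if u = 0 then 1 else snd x (u - 1, v - 1))"
  by (cases x) (simp add: array_prepend_def upper_def)

lemma fst_face:
  "i \<le> n \<Longrightarrow> l \<le> n \<Longrightarrow> fst (array_face eps n i x) l =
     (if l < i then fst x l
      else if l = i then fst x i * fst x (Suc i) * eps (snd x (i, Suc i)) else fst x (Suc l))"
  by (cases x) (simp add: array_face_def)

text \<open>The merged position \<open>i\<close> has the two preimages \<open>i\<close> and \<open>i + 1\<close>, every other position has one, so each
product has one or two factors.\<close>

lemma snd_face:
  assumes i: "i \<le> n" and uv: "u < v" "v \<le> n"
  shows "snd (array_face eps n i x) (u, v) =
     (if v < i then snd x (u, v)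
      else if v = i then snd x (u, i) * snd x (u, Suc i)
      else if u < i then snd x (u, Suc v)
      else if u = i then snd x (i, Suc v) * snd x (Suc i, Suc v)
      else snd x (Suc u, Suc v))"
proof -
  obtain a b where x: "x = (a, b)" by (cases x)
  have fib: "{p. p \<le> Suc n \<and> merge_index i p = w}
      = (if w < i then {w} else if w = i then {i, Suc i} else {Suc w})" if "w \<le> n" for w
    using i that by (auto simp: merge_index_def split: if_splits)
  have "{(p, q). p \<le> Suc n \<and> q \<le> Suc n \<and> merge_index i p = u \<and> merge_index i q = v}
      = {p. p \<le> Suc n \<and> merge_index i p = u} \<times> {q. q \<le> Suc n \<and> merge_index i q = v}"
    by auto
  then have "snd (array_face eps n i x) (u, v)
      = (\<Prod>p\<in>{p. p \<le> Suc n \<and> merge_index i p = u}. \<Prod>q\<in>{q. q \<le> Suc n \<and> merge_index i q = v}. b (p, q))"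
    using i uv by (simp add: x array_face_def upper_def prod.cartesian_product)
  then show ?thesis using uv by (simp add: fib x)
qed

lemma fst_face_last:
  "l \<le> n \<Longrightarrow> fst (array_face eps n (Suc n) x) l =
     (if l = 0 then fst x (Suc n) * fst x 0 * eps (snd x (0, Suc n)) else fst x l)"
  by (cases x) (simp add: array_face_def)

lemma snd_face_last:
  "u < v \<Longrightarrow> v \<le> n \<Longrightarrow> snd (array_face eps n (Suc n) x) (u, v) =
     (if u = 0 then snd x (v, Suc n) * snd x (0, v) else snd x (u, v))"
  by (cases x) (simp add: array_face_def upper_def)

lemmas array_entries = fst_rotate snd_rotate fst_prepend snd_prepend fst_face snd_face
  fst_face_last snd_face_last

text \<open>After \<open>k\<close> rotations the last \<open>k\<close> indices have been moved to the front.  If exactly one of the two indices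
of an entry has been moved, their order is reversed, hence the three cases.\<close>

lemma rotate_power:
  assumes "k \<le> Suc n"
  shows "l \<le> n \<Longrightarrow> fst ((array_rotate n ^^ k) x) l = fst x (if l < k then l + Suc n - k else l - k)"
    and "u < v \<Longrightarrow> v \<le> n \<Longrightarrow> snd ((array_rotate n ^^ k) x) (u, v) =
      snd x (if v < k then (u + Suc n - k, v + Suc n - k)
             else if u < k then (v - k, u + Suc n - k) else (u - k, v - k))"
  using assms
proof (induction k arbitrary: l u v)
  case (Suc k)
  {
    case 1
    then show ?case using Suc.IH(1) by (auto simp: fst_rotate Suc_diff_le)
  next
    case 2
    then show ?case using Suc.IH(2) by (auto simp: snd_rotate Suc_diff_le)
  }
qed simp_all

lemma rotate_cyclic:
  assumes "x \<in> arrays n" shows "(array_rotate n ^^ Suc n) x = x"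
proof (rule array_eqI[OF _ assms])
  show "(array_rotate n ^^ Suc n) x \<in> arrays n" by (simp add: array_ops_in_arrays)
qed (use rotate_power[of "Suc n" n] in \<open>simp_all del: funpow.simps\<close>)

lemma face_rotate_0: "array_face eps n 0 (array_rotate (Suc n) x) = array_face eps n (Suc n) x"
  by (rule array_eqI[of _ n]) (auto simp: array_ops_in_arrays array_entries)

lemma face_rotate_Suc:
  assumes "i \<le> n"
  shows "array_face eps n (Suc i) (array_rotate (Suc n) x) = array_rotate n (array_face eps n i x)"
proof (cases "i = n")
  case True
  then show ?thesis
    by (intro array_eqI[of _ n]) (auto simp: array_ops_in_arrays array_entries)
next
  case False
  with assms have "Suc i \<le> n" by simp
  then show ?thesis
    by (intro array_eqI[of _ n]) (auto simp: array_ops_in_arrays array_entries)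
qed

lemma face_prepend_0:
  assumes "x \<in> arrays n" "eps 1 = 1"
  shows "array_face eps n 0 (array_prepend n x) = x"
  by (rule array_eqI[of _ n]) (auto simp: array_ops_in_arrays array_entries assms)

lemma face_prepend_Suc:
  assumes "i \<le> n"
  shows "array_face eps (Suc n) (Suc i) (array_prepend (Suc n) x) = array_prepend n (array_face eps n i x)"
  using assms by (intro array_eqI[of _ "Suc n"]) (auto simp: array_ops_in_arrays array_entries)

text \<open>For \<open>j = 0\<close> both sides merge the indices \<open>0, 1, 2\<close>, in different order.  The results agree because the factors
\<open>eps (b (p, q))\<close> can be moved past the elements of the algebra and collected.\<close>

lemma face_face_0:
  assumes j: "j \<le> n" and mult: "\<And>b c. eps (b * c) = eps b * eps c"
    and central: "\<And>b x. eps b * x = x * eps b"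
  shows "array_face eps n 0 (array_face eps (Suc n) (Suc j) x)
    = array_face eps n j (array_face eps (Suc n) 0 x)"
proof (rule array_eqI[of _ n])
  fix l assume l: "l \<le> n"
  have triple: "a * (b * c * eps r) * eps (p * q) = a * b * eps p * c * eps (q * r)"
    for a b c p q r
  proof -
    have "a * (b * c * eps r) * eps (p * q) = a * b * (c * eps (r * (p * q)))"
      by (simp add: mult mult.assoc)
    also have "r * (p * q) = p * (q * r)" by (simp add: ac_simps)
    also have "a * b * (c * eps (p * (q * r))) = a * b * ((c * eps p) * eps (q * r))"
      by (simp add: mult mult.assoc)
    also have "c * eps p = eps p * c" by (simp add: central)
    finally show ?thesis by (simp add: mult.assoc)
  qed
  show "fst (array_face eps n 0 (array_face eps (Suc n) (Suc j) x)) l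
      = fst (array_face eps n j (array_face eps (Suc n) 0 x)) l"
  proof (cases "j = 0")
    case True
    with l show ?thesis by (auto simp: array_entries triple)
  next
    case False
    with l j show ?thesis by (auto simp: array_entries)
  qed
qed (use j in \<open>auto simp: array_ops_in_arrays array_entries ac_simps\<close>)

section \<open>Pulling back cochains\<close>

lemma sum_fun_apply: "(\<Sum>i\<in>I. f i) x = (\<Sum>i\<in>I. f i x)"
  by (induction I rule: infinite_finite_induct) simp_all

lemma vector_space_cochain_scale: "vector_space (cochain_scale :: 'k::field \<Rightarrow> ('x \<Rightarrow> 'k) \<Rightarrow> _)"
  by unfold_locales (auto simp: cochain_scale_def algebra_simps fun_eq_iff)

interpretation cochain: vector_space "cochain_scale :: 'k::field \<Rightarrow> ('x \<Rightarrow> 'k) \<Rightarrow> _"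
  by (rule vector_space_cochain_scale)

context
  fixes scA :: "'k::field \<Rightarrow> 'a::ab_group_add \<Rightarrow> 'a" and scB :: "'k \<Rightarrow> 'b::ab_group_add \<Rightarrow> 'b"
begin

definition chain_map ::
    "(('a, 'b) array \<Rightarrow> ('a, 'b) array) \<Rightarrow> nat
      \<Rightarrow> (('a, 'b) array \<Rightarrow>\<^sub>0 'k) set \<Rightarrow> (('a, 'b) array \<Rightarrow>\<^sub>0 'k) set" where
  "chain_map g n = induced_map (free_map g) (tensor_rel scA scB n)"

text \<open>Cochains vanish outside the chains, and so must their pullbacks.\<close>

definition pullback ::
    "nat \<Rightarrow> nat \<Rightarrow> (('a, 'b) array \<Rightarrow> ('a, 'b) array) \<Rightarrow> ('a, 'b, 'k) cochain \<Rightarrow> ('a, 'b, 'k) cochain" where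
  "pullback m n g \<phi> = (\<lambda>U. if U \<in> chains scA scB m then \<phi> (chain_map g n U) else 0)"

lemma chain_map_coset:
  assumes "tensor_map scA scB m n g"
  shows "chain_map g n (f +o tensor_rel scA scB m) = free_map g f +o tensor_rel scA scB n"
  unfolding chain_map_def
  using assms free.subspace_0[OF subspace_tensor_rel]
  by (intro induced_map_coset[OF module_hom_free_map subspace_tensor_rel])
    (auto simp: tensor_map_def)

lemma chain_map_linear:
  assumes "tensor_map scA scB m n g"
  shows "quotient_linear free_scale (free_arrays m) (tensor_rel scA scB m)
    (free_arrays n) (tensor_rel scA scB n) (chain_map g n)"
  unfolding chain_map_def
  by (rule quotient_linear_induced_map[OF module_hom_free_map subspace_tensor_rel subspace_tensor_rel])
    (use assms in \<open>auto simp: tensor_map_def intro: free_map_in_free_arrays\<close>)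

lemma chain_map_in:
  assumes "tensor_map scA scB m n g" "U \<in> chains scA scB m"
  shows "chain_map g n U \<in> chains scA scB n"
  using chain_map_linear[OF assms(1)] assms(2) by (auto simp: quotient_linear_def chains_def)

lemma chain_map_comp:
  assumes "tensor_map scA scB l m h" "tensor_map scA scB m n g" "U \<in> chains scA scB l"
  shows "chain_map g n (chain_map h m U) = chain_map (g \<circ> h) n U"
  using assms tensor_map_comp[OF assms(1,2)]
  by (auto simp: chains_def quotient_space_def chain_map_coset free_map_comp)

lemma chain_map_cong:
  assumes "tensor_map scA scB m n g" "tensor_map scA scB m n h"
    and "\<And>x. x \<in> arrays m \<Longrightarrow> g x = h x" "U \<in> chains scA scB m"
  shows "chain_map g n U = chain_map h n U"
proof -
  obtain f where f: "f \<in> free_arrays m" "U = f +o tensor_rel scA scB m"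
    using assms(4) by (auto simp: chains_def quotient_space_def)
  then have "free_map g f = free_map h f"
    using assms(3) by (intro free_map_cong) (auto simp: free_arrays_def)
  then show ?thesis using f assms(1,2) by (simp add: chain_map_coset)
qed

lemma subspace_cochains: "cochain.subspace (cochains scA scB n)"
  by (rule cochain.subspaceI) (auto simp: cochains_def cochain_scale_def algebra_simps)

lemma hom_pullback: "module_hom cochain_scale cochain_scale (pullback m n g)"
  by (intro module_hom.intro cochain.module_axioms module_hom_axioms.intro)
    (auto simp: pullback_def cochain_scale_def fun_eq_iff)

lemma pullback_in:
  assumes g: "tensor_map scA scB m n g" and \<phi>: "\<phi> \<in> cochains scA scB n"
  shows "pullback m n g \<phi> \<in> cochains scA scB m"
proof -
  have closed: "U + V \<in> chains scA scB m"
    "coset_scale free_scale (tensor_rel scA scB m) c U \<in> chains scA scB m"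
    if "U \<in> chains scA scB m" "V \<in> chains scA scB m" for U V c
    using that unfolding chains_def
    by (auto intro: quotient_space_closed[OF free.module_axioms subspace_free_arrays
          subspace_tensor_rel])
  show ?thesis
    using \<phi> chain_map_linear[OF g] chain_map_in[OF g] closed
    unfolding cochains_def quotient_linear_def chains_def[symmetric]
    by (auto simp: pullback_def)
qed

lemma pullback_comp:
  assumes "tensor_map scA scB l m h" "tensor_map scA scB m n g"
  shows "pullback l m h (pullback m n g \<phi>) = pullback l n (g \<circ> h) \<phi>"
  using chain_map_comp[OF assms] chain_map_in[OF assms(1)] by (auto simp: pullback_def)

lemma pullback_cong:
  assumes "tensor_map scA scB m n g" "tensor_map scA scB m n h"
    and "\<And>x. x \<in> arrays m \<Longrightarrow> g x = h x"
  shows "pullback m n g = pullback m n h"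
  using chain_map_cong[OF assms] by (auto simp: pullback_def fun_eq_iff)

lemma pullback_square:
  assumes h: "tensor_map scA scB l m h" and g: "tensor_map scA scB m n g"
    and h': "tensor_map scA scB l m' h'" and g': "tensor_map scA scB m' n g'"
    and eq: "\<And>x. x \<in> arrays l \<Longrightarrow> g (h x) = g' (h' x)"
  shows "pullback l m h (pullback m n g \<phi>) = pullback l m' h' (pullback m' n g' \<phi>)"
  unfolding pullback_comp[OF h g] pullback_comp[OF h' g']
  by (subst pullback_cong[OF tensor_map_comp[OF h g] tensor_map_comp[OF h' g']]) (simp_all add: eq)

lemma pullback_ident:
  assumes "\<phi> \<in> cochains scA scB n" shows "pullback n n (\<lambda>x. x) \<phi> = \<phi>"
proof -
  have "chain_map (\<lambda>x. x) n U = U" if "U \<in> chains scA scB n" for U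
    using that
    by (auto simp: chains_def quotient_space_def chain_map_coset tensor_map_ident free_map_ident)
  then show ?thesis using assms by (auto simp: pullback_def cochains_def)
qed

lemma pullback_funpow:
  assumes g: "tensor_map scA scB n n g" and \<phi>: "\<phi> \<in> cochains scA scB n"
  shows "(pullback n n g ^^ j) \<phi> = pullback n n (g ^^ j) \<phi>"
proof (induction j)
  case 0
  show ?case using pullback_ident[OF \<phi>] by (simp add: id_def)
next
  case (Suc j)
  have "(pullback n n g ^^ Suc j) \<phi> = pullback n n (g ^^ j \<circ> g) \<phi>"
    by (simp add: Suc.IH pullback_comp[OF g tensor_map_funpow[OF g]])
  then show ?case by (simp only: funpow_Suc_right)
qed

end

section \<open>The cocyclic module of the triple\<close>

locale central_triple = A: k_algebra scA + B: k_algebra scB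
  for scA :: "'k::field_char_0 \<Rightarrow> 'a::{ring,monoid_mult} \<Rightarrow> 'a"
    and scB :: "'k \<Rightarrow> 'b::{comm_ring,comm_monoid_mult} \<Rightarrow> 'b" +
  fixes eps :: "'b \<Rightarrow> 'a"
  assumes eps_hom: "algebra_hom scB scA eps"
    and eps_central: "eps b * x = x * eps b"
begin

lemma hom_eps: "module_hom scB scA eps"
  using eps_hom by (simp add: algebra_hom_def Vector_Spaces.linear_iff_module_hom)

lemma eps_1: "eps 1 = 1" and eps_mult: "eps (b * c) = eps b * eps c"
  using eps_hom by (auto simp: algebra_hom_def)

lemma hom_mult:
  "module_hom scA scA (\<lambda>z. x * z * y)" "module_hom scB scB (\<lambda>z. b * z)"
  "module_hom scB scA (\<lambda>z. x * eps z)"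
  by (intro module_hom.intro module_hom_axioms.intro A.module_axioms B.module_axioms;
      simp add: algebra_simps A.scale_mult_left A.scale_mult_right B.scale_mult_right
        module_hom.add[OF hom_eps] module_hom.scale[OF hom_eps])+

lemma tensor_map_rotate: "tensor_map scA scB n n (array_rotate n)"
proof (rule tensor_mapI)
  fix x :: "('a, 'b) array" and l assume "x \<in> arrays n" "l \<le> n"
  then show "\<exists>l' L. l' \<le> n \<and> module_hom scA scA L \<and>
      (\<forall>z. array_rotate n (apfst (\<lambda>a. a(l := z)) x) = apfst (\<lambda>a. a(l' := L z)) (array_rotate n x))"
    by (intro exI[of _ "if l = n then 0 else Suc l"] exI[of _ "\<lambda>z. z"] conjI allI
        array_eqI[of _ n] arrays_update array_rotate_in module.module_hom_ident[OF A.module_axioms])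
      (auto simp: array_entries)
next
  fix x :: "('a, 'b) array" and e assume "x \<in> arrays n" "e \<in> upper n"
  moreover obtain p q where "e = (p, q)" by (cases e)
  ultimately have "\<exists>e' L. e' \<in> upper n \<and> module_hom scB scB L \<and>
      (\<forall>z. array_rotate n (apsnd (\<lambda>b. b(e := z)) x) = apsnd (\<lambda>b. b(e' := L z)) (array_rotate n x))"
    by (intro exI[of _ "if q = n then (0, Suc p) else (Suc p, Suc q)"] exI[of _ "\<lambda>z. z"] conjI allI
        array_eqI[of _ n] arrays_update array_rotate_in module.module_hom_ident[OF B.module_axioms])
      (auto simp: array_entries upper_def)
  then show "(\<exists>l' L. l' \<le> n \<and> module_hom scB scA L \<and>
      (\<forall>z. array_rotate n (apsnd (\<lambda>b. b(e := z)) x) = apfst (\<lambda>a. a(l' := L z)) (array_rotate n x))) \<or>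
      (\<exists>e' L. e' \<in> upper n \<and> module_hom scB scB L \<and>
      (\<forall>z. array_rotate n (apsnd (\<lambda>b. b(e := z)) x) = apsnd (\<lambda>b. b(e' := L z)) (array_rotate n x)))"
    by blast
qed (rule array_rotate_in)

lemma tensor_map_prepend: "tensor_map scA scB n (Suc n) (array_prepend n)"
proof (rule tensor_mapI)
  fix x :: "('a, 'b) array" and l assume "x \<in> arrays n" "l \<le> n"
  then show "\<exists>l' L. l' \<le> Suc n \<and> module_hom scA scA L \<and>
      (\<forall>z. array_prepend n (apfst (\<lambda>a. a(l := z)) x) = apfst (\<lambda>a. a(l' := L z)) (array_prepend n x))"
    by (intro exI[of _ "Suc l"] exI[of _ "\<lambda>z. z"] conjI allI
        array_eqI[of _ "Suc n"] arrays_update array_prepend_in module.module_hom_ident[OF A.module_axioms])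
      (auto simp: array_entries)
next
  fix x :: "('a, 'b) array" and e assume "x \<in> arrays n" "e \<in> upper n"
  moreover obtain p q where "e = (p, q)" by (cases e)
  ultimately have "\<exists>e' L. e' \<in> upper (Suc n) \<and> module_hom scB scB L \<and>
      (\<forall>z. array_prepend n (apsnd (\<lambda>b. b(e := z)) x) = apsnd (\<lambda>b. b(e' := L z)) (array_prepend n x))"
    by (intro exI[of _ "(Suc p, Suc q)"] exI[of _ "\<lambda>z. z"] conjI allI
        array_eqI[of _ "Suc n"] arrays_update array_prepend_in module.module_hom_ident[OF B.module_axioms])
      (auto simp: array_entries upper_def)
  then show "(\<exists>l' L. l' \<le> Suc n \<and> module_hom scB scA L \<and>
      (\<forall>z. array_prepend n (apsnd (\<lambda>b. b(e := z)) x) = apfst (\<lambda>a. a(l' := L z)) (array_prepend n x))) \<or>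
      (\<exists>e' L. e' \<in> upper (Suc n) \<and> module_hom scB scB L \<and>
      (\<forall>z. array_prepend n (apsnd (\<lambda>b. b(e := z)) x) = apsnd (\<lambda>b. b(e' := L z)) (array_prepend n x)))"
    by blast
qed (rule array_prepend_in)

text \<open>The diagonal entries \<open>0\<close> and \<open>1\<close> and the entry between them meet in one product on the diagonal; a pair
\<open>b (0, q)\<close>, \<open>b (1, q)\<close> meets in one product above it; all other entries are only moved.\<close>

lemma tensor_map_face_0: "tensor_map scA scB (Suc n) n (array_face eps n 0)"
proof (rule tensor_mapI)
  fix x :: "('a, 'b) array" and l assume x: "x \<in> arrays (Suc n)" and l: "l \<le> Suc n"
  obtain a b where ab: "x = (a, b)" by (cases x)
  \<comment> \<open>The factor \<open>1\<close> gives the case \<open>l = 0\<close> the shape of \<open>hom_mult\<close>.\<close>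
  let ?L = "\<lambda>z. if l = 0 then 1 * z * (a 1 * eps (b (0, 1)))
    else if l = 1 then a 0 * z * eps (b (0, 1)) else z"
  have "module_hom scA scA ?L"
    using hom_mult(1)[of 1] hom_mult(1)[of "a 0"] module.module_hom_ident[OF A.module_axioms]
    by (cases "l = 0"; cases "l = 1") (simp_all only: if_True if_False refl zero_neq_one)
  moreover have "array_face eps n 0 (apfst (\<lambda>a. a(l := z)) x)
      = apfst (\<lambda>a. a(l - 1 := ?L z)) (array_face eps n 0 x)" for z
    using l by (intro array_eqI[of _ n] arrays_update array_face_in)
      (auto simp: array_entries ab mult.assoc)
  ultimately show "\<exists>l' L. l' \<le> n \<and> module_hom scA scA L \<and>
      (\<forall>z. array_face eps n 0 (apfst (\<lambda>a. a(l := z)) x) = apfst (\<lambda>a. a(l' := L z)) (array_face eps n 0 x))"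
    using l by (intro exI[of _ "l - 1"] exI[of _ ?L]) auto
next
  fix x :: "('a, 'b) array" and e assume x: "x \<in> arrays (Suc n)" and e: "e \<in> upper (Suc n)"
  obtain a b where ab: "x = (a, b)" by (cases x)
  obtain p q where pq: "e = (p, q)" "p < q" "q \<le> Suc n" using e by (auto simp: upper_def)
  show "(\<exists>l' L. l' \<le> n \<and> module_hom scB scA L \<and>
      (\<forall>z. array_face eps n 0 (apsnd (\<lambda>b. b(e := z)) x) = apfst (\<lambda>a. a(l' := L z)) (array_face eps n 0 x))) \<or>
      (\<exists>e' L. e' \<in> upper n \<and> module_hom scB scB L \<and>
      (\<forall>z. array_face eps n 0 (apsnd (\<lambda>b. b(e := z)) x) = apsnd (\<lambda>b. b(e' := L z)) (array_face eps n 0 x)))"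
  proof (cases "q = 1")
    case True
    have "array_face eps n 0 (apsnd (\<lambda>b. b(e := z)) x)
        = apfst (\<lambda>c. c(0 := a 0 * a 1 * eps z)) (array_face eps n 0 x)" for z
      using pq True by (intro array_eqI[of _ n] arrays_update array_face_in)
        (auto simp: array_entries ab)
    then show ?thesis using hom_mult(3) by blast
  next
    case False
    let ?L = "\<lambda>z. if p = 0 then b (1, q) * z else if p = 1 then b (0, q) * z else z"
    have "module_hom scB scB ?L"
        using hom_mult(2) module.module_hom_ident[OF B.module_axioms]
      by (cases "p = 0"; cases "p = 1") (simp_all only: if_True if_False refl zero_neq_one)
    moreover have "(p - 1, q - 1) \<in> upper n" using pq False by (auto simp: upper_def)
    moreover have "array_face eps n 0 (apsnd (\<lambda>b. b(e := z)) x)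
        = apsnd (\<lambda>c. c((p - 1, q - 1) := ?L z)) (array_face eps n 0 x)" for z
      using pq False \<open>(p - 1, q - 1) \<in> upper n\<close>
      by (intro array_eqI[of _ n] arrays_update array_face_in)
        (auto simp: array_entries ab mult.commute)
    ultimately show ?thesis by blast
  qed
qed (rule array_face_in)

text \<open>Every face arises from the face at \<open>0\<close> by conjugation with rotations.\<close>

text \<open>Every face arises from the face at \<open>0\<close> by conjugation with rotations, which spares the case distinction
for faces in general position.\<close>

lemma tensor_map_face:
  assumes "i \<le> Suc n" shows "tensor_map scA scB (Suc n) n (array_face eps n i)"
  using assms
proof (induction i)
  case 0
  show ?case by (rule tensor_map_face_0)
next
  case (Suc i)
  let ?g = "array_rotate n \<circ> array_face eps n i \<circ> (array_rotate (Suc n) ^^ Suc n)"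
  have "?g x = array_face eps n (Suc i) x" if "x \<in> arrays (Suc n)" for x :: "('a, 'b) array"
    using face_rotate_Suc[of i n eps "(array_rotate (Suc n) ^^ Suc n) x"] Suc.prems
      rotate_cyclic[OF that] by simp
  moreover have "tensor_map scA scB (Suc n) n ?g"
    by (rule tensor_map_comp[OF tensor_map_funpow[OF tensor_map_rotate]
          tensor_map_comp[OF Suc.IH tensor_map_rotate]]) (use Suc.prems in simp)
  ultimately show ?case by (rule tensor_map_cong)
qed

lemma cocyclic:
  "cocyclic_module cochain_scale (cochains scA scB)
     (\<lambda>n i. pullback scA scB (Suc n) n (array_face eps n i))
     (\<lambda>n. pullback scA scB n n (array_rotate n))
     (\<lambda>n. pullback scA scB n (Suc n) (array_prepend n))"
proof (intro cocyclic_module.intro cochain.vector_space_axioms cocyclic_module_axioms.intro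
    subspace_cochains hom_pullback)
  note maps = tensor_map_face tensor_map_rotate tensor_map_prepend
  fix n i j :: nat and \<phi>
  show "pullback scA scB (Suc n) n (array_face eps n i) \<phi> \<in> cochains scA scB (Suc n)"
    if "i \<le> Suc n" "\<phi> \<in> cochains scA scB n"
    using that by (intro pullback_in maps)
  show "pullback scA scB n n (array_rotate n) \<phi> \<in> cochains scA scB n"
    if "\<phi> \<in> cochains scA scB n"
    using that by (intro pullback_in maps)
  show "pullback scA scB n (Suc n) (array_prepend n) \<phi> \<in> cochains scA scB n"
    if "\<phi> \<in> cochains scA scB (Suc n)"
    using that by (intro pullback_in maps)
  show "(pullback scA scB n n (array_rotate n) ^^ Suc n) \<phi> = \<phi>" if "\<phi> \<in> cochains scA scB n"
  proof -
    have "pullback scA scB n n (array_rotate n ^^ Suc n) = pullback scA scB n n (\<lambda>x. x)"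
      by (intro pullback_cong tensor_map_funpow maps tensor_map_ident rotate_cyclic)
    then show ?thesis
      using that by (simp only: pullback_funpow[OF maps(2)] pullback_ident)
  qed
  show "pullback scA scB (Suc n) (Suc n) (array_rotate (Suc n))
      (pullback scA scB (Suc n) n (array_face eps n 0) \<phi>)
    = pullback scA scB (Suc n) n (array_face eps n (Suc n)) \<phi>" if "\<phi> \<in> cochains scA scB n"
    unfolding pullback_comp[OF maps(2) maps(1)[OF le0]]
    by (subst pullback_cong[OF tensor_map_comp[OF maps(2) maps(1)[OF le0]] maps(1)[OF order_refl]])
      (simp_all add: face_rotate_0)
  show "pullback scA scB (Suc n) (Suc n) (array_rotate (Suc n))
      (pullback scA scB (Suc n) n (array_face eps n (Suc i)) \<phi>)
    = pullback scA scB (Suc n) n (array_face eps n i) (pullback scA scB n n (array_rotate n) \<phi>)"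
    if "i \<le> n" "\<phi> \<in> cochains scA scB n"
    using that
    by (intro pullback_square maps face_rotate_Suc) simp_all
  show "pullback scA scB (Suc (Suc n)) (Suc n) (array_face eps (Suc n) (Suc j))
      (pullback scA scB (Suc n) n (array_face eps n 0) \<phi>)
    = pullback scA scB (Suc (Suc n)) (Suc n) (array_face eps (Suc n) 0)
      (pullback scA scB (Suc n) n (array_face eps n j) \<phi>)"
    if "j \<le> n" "\<phi> \<in> cochains scA scB n"
    using that
    by (intro pullback_square maps face_face_0 eps_mult eps_central) simp_all
  show "pullback scA scB n (Suc n) (array_prepend n)
      (pullback scA scB (Suc n) n (array_face eps n 0) \<phi>) = \<phi>" if "\<phi> \<in> cochains scA scB n"
  proof -
    have "pullback scA scB n n (array_face eps n 0 \<circ> array_prepend n) = pullback scA scB n n (\<lambda>x. x)"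
      by (intro pullback_cong tensor_map_ident tensor_map_comp[OF maps(3) maps(1)])
        (simp_all add: face_prepend_0 eps_1)
    then show ?thesis
      using that by (simp only: pullback_comp[OF maps(3) maps(1)[OF le0]] pullback_ident)
  qed
  show "pullback scA scB (Suc n) (Suc (Suc n)) (array_prepend (Suc n))
      (pullback scA scB (Suc (Suc n)) (Suc n) (array_face eps (Suc n) (Suc i)) \<phi>)
    = pullback scA scB (Suc n) n (array_face eps n i) (pullback scA scB n (Suc n) (array_prepend n) \<phi>)"
    if "i \<le> n" "\<phi> \<in> cochains scA scB (Suc n)"
    using that
    by (intro pullback_square maps face_prepend_Suc) simp_all
qed

text \<open>The cochain complexes of the triple are those of this cocyclic module, and their cyclic cochains are
the kernel of \<open>t\<close>.\<close>

sublocale cocyclic_module cochain_scale "cochains scA scB"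
  "\<lambda>n i. pullback scA scB (Suc n) n (array_face eps n i)"
  "\<lambda>n. pullback scA scB n n (array_rotate n)"
  "\<lambda>n. pullback scA scB n (Suc n) (array_prepend n)"
  by (rule cocyclic)

lemma codiff_eq: "codiff scA scB eps n = d n"
  by (intro ext)
    (simp add: codiff_def d_def \<delta>s_def sum_fun_apply cochain_scale_def pullback_def chain_map_def
      induced_map_def face_def del: sum.atMost_Suc)

lemma cyclic_cochains_eq: "cyclic_cochains scA scB n = {\<phi> \<in> cochains scA scB n. t n \<phi> = 0}"
proof -
  have "cyclic_act scA scB n = \<rho> n"
    by (intro ext) (simp add: cyclic_act_def \<rho>_def cochain_scale_def pullback_def chain_map_def
        induced_map_def rotate_chain_def)
  then show ?thesis by (auto simp: cyclic_cochains_def t_def)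
qed

sublocale bicomplex: periodic_bicomplex cochain_scale "int_spaces (cochains scA scB)"
  "int_maps d" "int_maps d'" "int_maps (\<lambda>n. pullback scA scB n (Suc n) (array_prepend n))"
  "int_maps t" "int_maps N" "int_maps D" "int_maps E"
  by (rule periodic_bicomplex)

lemma HH_cocycles_eq: "HH_cocycles scA scB eps n = bicomplex.Z n"
  by (auto simp: HH_cocycles_def cocycles_def bicomplex.Z_def int_spaces_def int_maps_def codiff_eq)

lemma HH_coboundaries_eq:
  "HH_coboundaries scA scB eps n = int_maps d (n - 1) ` int_spaces (cochains scA scB) (n - 1)"
  by (auto simp: HH_coboundaries_def coboundaries_def int_spaces_def int_maps_def codiff_eq)

lemma bicomplex_K: "bicomplex.K n = int_spaces (cyclic_cochains scA scB) n"
  by (auto simp: bicomplex.K_def int_spaces_def int_maps_def cyclic_cochains_eq)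

lemma HC_cocycles_eq: "HC_cocycles scA scB eps n = bicomplex.ZK n"
  by (auto simp: HC_cocycles_def cocycles_def bicomplex.ZK_def bicomplex_K int_spaces_def
      int_maps_def codiff_eq)

lemma HC_coboundaries_eq:
  "HC_coboundaries scA scB eps n = int_maps d (n - 1) ` bicomplex.K (n - 1)"
  by (auto simp: HC_coboundaries_def coboundaries_def int_spaces_def int_maps_def codiff_eq bicomplex_K)

end

theorem theorem3p9:
  fixes scA :: "'k::field_char_0 \<Rightarrow> 'a::{ring,monoid_mult} \<Rightarrow> 'a"
    and scB :: "'k \<Rightarrow> 'b::{comm_ring,comm_monoid_mult} \<Rightarrow> 'b"
    and eps :: "'b \<Rightarrow> 'a"
  assumes "k_algebra scA"
    and "k_algebra scB"
    and "algebra_hom scB scA eps"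
    and "\<And>b x. eps b * x = x * eps b"
  shows "\<exists>(B_map :: int \<Rightarrow> ('a, 'b, 'k) cochain set \<Rightarrow> ('a, 'b, 'k) cochain set)
          (S_map :: int \<Rightarrow> ('a, 'b, 'k) cochain set \<Rightarrow> ('a, 'b, 'k) cochain set).
    \<forall>n::int.
      HC_to_HH_linear scA scB eps n n (I_map scA scB eps n) \<and>
      HH_to_HC_linear scA scB eps n (n - 1) (B_map n) \<and>
      HC_to_HC_linear scA scB eps (n - 1) (n + 1) (S_map n) \<and>
      I_map scA scB eps n ` HC scA scB eps n
        = {X \<in> HH scA scB eps n. B_map n X = HC_coboundaries scA scB eps (n - 1)} \<and>
      B_map n ` HH scA scB eps n
        = {X \<in> HC scA scB eps (n - 1). S_map n X = HC_coboundaries scA scB eps (n + 1)} \<and>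
      S_map n ` HC scA scB eps (n - 1)
        = {X \<in> HC scA scB eps (n + 1). I_map scA scB eps (n + 1) X = HH_coboundaries scA scB eps (n + 1)}"
proof -
  interpret central_triple scA scB eps
    using assms by (intro central_triple.intro central_triple_axioms.intro)
  have I: "I_map scA scB eps n = induced_map (\<lambda>x. x) (HH_coboundaries scA scB eps n)" for n
    by (intro ext) (simp add: I_map_def induced_map_def)
  have idx: "n - 1 - 1 = n - 2" "n + 1 - 1 = n" for n :: int by simp_all
  show ?thesis
    unfolding HC_to_HH_linear_def HH_to_HC_linear_def HC_to_HC_linear_def HC_def HH_def I
      HH_cocycles_eq HH_coboundaries_eq HC_cocycles_eq HC_coboundaries_eq idx
    by (rule exI[of _ "\<lambda>n. induced_map (bicomplex.connecting (n - 1))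
          (int_maps d (n - 2) ` bicomplex.K (n - 2))"],
        rule exI[of _ "\<lambda>n. induced_map (bicomplex.periodicity (n - 1))
          (int_maps d n ` bicomplex.K n)"],
        intro allI conjI bicomplex.long_exact_sequence)
qed

end
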